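(* Let $(W,S)$ be a finite Coxeter system with longest element $w_0$, and let $[1,w_0]_{\mathcal B}$ be its Bruhat graph. (i) If $(W,S)$ is of type $A_n$ with $n\ge 1$, then $[1,w_0]_{\mathcal B}$ is cubulated by the cubical lattice $\mathcal C(1,2,\dots,n)$. (ii) If $(W,S)$ is of type $B_n$ (equivalently $C_n$) with $n\ge 2$, then $[1,w_0]_{\mathcal B}$ is cubulated by the cubical lattice $\mathcal C(1,3,5,\dots,2n-1)$.
   Context: Let $(W,S)$ be a Coxeter system with word length $\ell$, set of reflections $\mathcal T=\{xsx^{-1}: x\in W, s\in S\}$, and Bruhat order $\le$ (generated by $x\le xt$ for $x\in W$, $t\in\mathcal T$, $\ell(xt)>\ell(x)$). If $W$ is finite then $[1,w_0]=W$. Bruhat graph: $\mathcal B$ is the directed graph with vertex set $W$ and an edge from $x$ to $xt$, for $t\in\mathcal T$, if and only if $\ell(xt)>\ell(x)$. For $W$ finite, $[1,w_0]_{\mathcal B}=\mathcal B$. Cubical lattice: for an integer $N\ge 1$ and $k_1,\dots,k_N\in\mathbb N=\{0,1,2,\dots\}$, $\mathcal C(k_1,\dots,k_N)$ is the directed graph with vertex set $\{(m_1,\dots,m_N)\in\mathbb Z^N: 0\le m_i\le k_i \text{ for all } i\}$ and an edge from $u$ to $v$ if and only if $v-u$ is a standard basis vector of $\mathbb Z^N$. A directed graph $\mathcal D$ is cubulated by $\mathcal C(k_1,\dots,k_N)$ if $\mathcal C(k_1,\dots,k_N)$ is isomorphic to a spanning subgraph of $\mathcal D$ (a subgraph, not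 necessarily induced, with the same vertex set as $\mathcal D$). *)

theory Defs
  imports "HOL-Algebra.Algebra" "Graph_Theory.Graph_Theory"
begin

section \<open>Coxeter systems\<close>

definition word_prod :: "('a, 'b) monoid_scheme \<Rightarrow> 'a list \<Rightarrow> 'a" where
  "word_prod W ws = foldr (\<lambda>x y. x \<otimes>\<^bsub>W\<^esub> y) ws \<one>\<^bsub>W\<^esub>"

text \<open>The order of \<open>s t\<close>, with value 0 standing for infinite order (the convention of
  \<^const>\<open>group.ord\<close>).\<close>

definition cox_m :: "('a, 'b) monoid_scheme \<Rightarrow> 'a \<Rightarrow> 'a \<Rightarrow> nat" where
  "cox_m W s t = group.ord W (s \<otimes>\<^bsub>W\<^esub> t)"

text \<open>The congruence on the free monoid over \<open>S\<close> generated by the Coxeter relations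
  \<open>(s t)^m(s,t) = 1\<close>.  If \<open>m(s,t)\<close> is infinite the relator is the empty word, so that no relation
  is imposed.  The relators with \<open>s = t\<close> are the words \<open>s s\<close>, so generators are their own inverses
  in the quotient, which is therefore the group presented by these relations.\<close>

inductive cox_equiv :: "('a, 'b) monoid_scheme \<Rightarrow> 'a set \<Rightarrow> 'a list \<Rightarrow> 'a list \<Rightarrow> bool"
  for W :: "('a, 'b) monoid_scheme" and S :: "'a set" where
  relator: "\<lbrakk>u \<in> lists S; v \<in> lists S; s \<in> S; t \<in> S\<rbrakk>
    \<Longrightarrow> cox_equiv W S (u @ concat (replicate (cox_m W s t) [s, t]) @ v) (u @ v)"
| refl: "u \<in> lists S \<Longrightarrow> cox_equiv W S u u"
| sym: "cox_equiv W S u v \<Longrightarrow> cox_equiv W S v u"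
| trans: "cox_equiv W S u v \<Longrightarrow> cox_equiv W S v w \<Longrightarrow> cox_equiv W S u w"

definition coxeter_system :: "('a, 'b) monoid_scheme \<Rightarrow> 'a set \<Rightarrow> bool" where
  "coxeter_system W S \<longleftrightarrow>
     group W \<and> S \<subseteq> carrier W \<and> (\<forall>s\<in>S. group.ord W s = 2) \<and> generate W S = carrier W \<and>
     (\<forall>u\<in>lists S. \<forall>v\<in>lists S. word_prod W u = word_prod W v \<longleftrightarrow> cox_equiv W S u v)"

text \<open>Types via the Coxeter diagram: a path \<open>s 1, \<dots>, s n\<close>, all of whose edges have label 3,
  except that for type \<open>B\<close> the last one has label 4.\<close>

definition coxeter_type_A :: "('a, 'b) monoid_scheme \<Rightarrow> 'a set \<Rightarrow> nat \<Rightarrow> bool" where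
  "coxeter_type_A W S n \<longleftrightarrow>
     (\<exists>s :: nat \<Rightarrow> 'a. bij_betw s {1..n} S \<and>
        (\<forall>i\<in>{1..n}. \<forall>j\<in>{1..n}. i < j \<longrightarrow>
           cox_m W (s i) (s j) = (if j = i + 1 then 3 else 2)))"

definition coxeter_type_B :: "('a, 'b) monoid_scheme \<Rightarrow> 'a set \<Rightarrow> nat \<Rightarrow> bool" where
  "coxeter_type_B W S n \<longleftrightarrow>
     (\<exists>s :: nat \<Rightarrow> 'a. bij_betw s {1..n} S \<and>
        (\<forall>i\<in>{1..n}. \<forall>j\<in>{1..n}. i < j \<longrightarrow>
           cox_m W (s i) (s j) = (if j = i + 1 then (if j = n then 4 else 3) else 2)))"

definition cox_length :: "('a, 'b) monoid_scheme \<Rightarrow> 'a set \<Rightarrow> 'a \<Rightarrow> nat" where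
  "cox_length W S x = (LEAST k. \<exists>ws\<in>lists S. length ws = k \<and> word_prod W ws = x)"

definition reflections :: "('a, 'b) monoid_scheme \<Rightarrow> 'a set \<Rightarrow> 'a set" where
  "reflections W S = {x \<otimes>\<^bsub>W\<^esub> s \<otimes>\<^bsub>W\<^esub> inv\<^bsub>W\<^esub> x | x s. x \<in> carrier W \<and> s \<in> S}"

definition longest_element :: "('a, 'b) monoid_scheme \<Rightarrow> 'a set \<Rightarrow> 'a \<Rightarrow> bool" where
  "longest_element W S w \<longleftrightarrow>
     w \<in> carrier W \<and> (\<forall>x\<in>carrier W. cox_length W S x \<le> cox_length W S w)"


section \<open>Bruhat graph and Bruhat order\<close>

definition bruhat_graph :: "('a, 'b) monoid_scheme \<Rightarrow> 'a set \<Rightarrow> 'a pair_pre_digraph" where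
  "bruhat_graph W S =
     \<lparr> pverts = carrier W,
       parcs = {(x, x \<otimes>\<^bsub>W\<^esub> t) | x t. x \<in> carrier W \<and> t \<in> reflections W S \<and>
                  cox_length W S x < cox_length W S (x \<otimes>\<^bsub>W\<^esub> t)} \<rparr>"

definition bruhat_le :: "('a, 'b) monoid_scheme \<Rightarrow> 'a set \<Rightarrow> 'a \<Rightarrow> 'a \<Rightarrow> bool" where
  "bruhat_le W S x y \<longleftrightarrow>
     x \<in> carrier W \<and> y \<in> carrier W \<and> (x, y) \<in> (parcs (bruhat_graph W S))\<^sup>*"

definition bruhat_interval :: "('a, 'b) monoid_scheme \<Rightarrow> 'a set \<Rightarrow> 'a \<Rightarrow> 'a \<Rightarrow> 'a set" where
  "bruhat_interval W S x y = {z. bruhat_le W S x z \<and> bruhat_le W S z y}"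

definition bruhat_interval_graph ::
    "('a, 'b) monoid_scheme \<Rightarrow> 'a set \<Rightarrow> 'a \<Rightarrow> 'a \<Rightarrow> ('a, 'a \<times> 'a) pre_digraph" where
  "bruhat_interval_graph W S x y =
     induce_subgraph (with_proj (bruhat_graph W S)) (bruhat_interval W S x y)"


section \<open>Cubulations\<close>

text \<open>Integer vectors with \<open>N\<close> coordinates are lists of length \<open>N\<close> (indexed from 0).\<close>

definition cubical_verts :: "nat list \<Rightarrow> int list set" where
  "cubical_verts k =
     {m. length m = length k \<and> (\<forall>i<length k. 0 \<le> m ! i \<and> m ! i \<le> int (k ! i))}"

definition cubical_lattice :: "nat list \<Rightarrow> int list pair_pre_digraph" where
  "cubical_lattice k =
     \<lparr> pverts = cubical_verts k,
       parcs = {(u, v). u \<in> cubical_verts k \<and> v \<in> cubical_verts k \<and>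
          (\<exists>i<length k. \<forall>j<length k. v ! j - u ! j = (if j = i then 1 else 0))} \<rparr>"

definition cubulated_by :: "('a, 'b) pre_digraph \<Rightarrow> nat list \<Rightarrow> bool" where
  "cubulated_by D k \<longleftrightarrow>
     (\<exists>H. spanning H D \<and> digraph_iso (with_proj (cubical_lattice k)) H)"

end

theory Submission
  imports Defs
begin

text \<open>
  Number the generators of \<open>B_N\<close> as \<open>g 0, \<dots>, g (N - 1)\<close> with the label 4 between \<open>g 0\<close> and \<open>g 1\<close>;
  type \<open>A_(N-1)\<close> is the parabolic subgroup generated by \<open>g 1, \<dots>, g (N - 1)\<close>.  Along the chain of
  parabolic subgroups generated by the letters below \<open>k\<close>, the minimal coset representatives at each
  stage are the prefixes of a single word \<open>g (k-1) \<dots> g 1 g 0 g 1 \<dots> g (k-1)\<close> (of \<open>g (k-1) \<dots> g 1\<close> in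
  type \<open>A\<close>).  Hence every element is a product \<open>c 1 \<dots> c N\<close> of such prefixes, and the vector of their
  lengths is the lattice point.  Lengthening one prefix by a letter \<open>s\<close> turns \<open>a b\<close> into
  \<open>a s b = a b (b\<^sup>-\<^sup>1 s b)\<close>, an edge of the Bruhat graph as soon as lengths add up.  Uniqueness and
  additivity of lengths are read off from the action on signed permutations: the prefix lengths are
  the entries of the Lehmer code, and a generator changes the sum of the code by at most one.
\<close>

section \<open>Signed permutations and their codes\<close>

text \<open>The generators of the hyperoctahedral group acting on the integers. Taking all of Z lets
  the same maps serve every rank, and type A uses only those with positive index.\<close>

definition signed_swap :: "nat \<Rightarrow> int \<Rightarrow> int" where
  "signed_swap i x =
     (if i = 0 then (if \<bar>x\<bar> = 1 then - x else x)
      else if x = int i then x + 1 else if x = int i + 1 then x - 1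
      else if x = - int i then x - 1 else if x = - int i - 1 then x + 1 else x)"

lemma signed_swap_minus [simp]: "signed_swap i (- x) = - signed_swap i x"
  by (auto simp: signed_swap_def)

text \<open>Since generators are odd maps, identities between them need checking only on nonnegative
  arguments, where two of the branches cannot occur.\<close>

lemma signed_swap_nonneg:
  assumes "0 \<le> x" "0 < i"
  shows "signed_swap i x = (if x = int i then int i + 1 else if x = int i + 1 then int i else x)"
  using assms by (simp add: signed_swap_def)

lemma signed_swap_involution [simp]: "signed_swap i (signed_swap i x) = x"
proof -
  have *: "signed_swap i (signed_swap i y) = y" if "0 \<le> y" for y
  proof (cases "i = 0")
    case True
    then show ?thesis by (simp add: signed_swap_def)
  next
    case False
    then show ?thesis using that by (simp add: signed_swap_nonneg)
  qed
  show ?thesis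
  proof (cases "0 \<le> x")
    case False
    then show ?thesis using *[of "- x"] by simp
  qed (rule *)
qed

lemma signed_swap_idle:
  assumes "\<bar>x\<bar> \<noteq> int i" "\<bar>x\<bar> \<noteq> int i + 1"
  shows "signed_swap i x = x"
proof -
  have "x \<noteq> int i" "x \<noteq> - int i" "x \<noteq> int i + 1" "x \<noteq> - int i - 1"
    using assms by linarith+
  then show ?thesis using assms by (simp add: signed_swap_def)
qed

lemma abs_signed_swap_le:
  assumes "i < k" "\<bar>x\<bar> \<le> int k"
  shows "\<bar>signed_swap i x\<bar> \<le> int k"
proof -
  have *: "\<bar>signed_swap i y\<bar> \<le> int k" if "0 \<le> y" "y \<le> int k" for y
  proof (cases "i = 0")
    case True
    then show ?thesis using that by (simp add: signed_swap_def)
  next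
    case False
    then show ?thesis using that assms(1) by (simp add: signed_swap_nonneg)
  qed
  show ?thesis
  proof (cases "0 \<le> x")
    case False
    then show ?thesis using *[of "- x"] assms(2) by simp
  qed (use * assms(2) in simp)
qed

text \<open>Both generators preserve the ball of radius \<open>i + 1\<close> and its complement;
  generator \<open>j\<close> is idle on the ball, generator \<open>i\<close> outside it.\<close>

lemma signed_swap_far:
  assumes "i + 1 < j"
  shows "signed_swap i (signed_swap j x) = signed_swap j (signed_swap i x)"
proof (cases "\<bar>x\<bar> \<le> int (i + 1)")
  case True
  have "\<bar>signed_swap i x\<bar> \<le> int (i + 1)" by (rule abs_signed_swap_le) (use True in auto)
  then show ?thesis using True assms by (simp add: signed_swap_idle[of _ j])
next
  case False
  have "\<not> \<bar>signed_swap j x\<bar> \<le> int (i + 1)"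
  proof
    assume "\<bar>signed_swap j x\<bar> \<le> int (i + 1)"
    then have "signed_swap j (signed_swap j x) = signed_swap j x"
      using assms by (intro signed_swap_idle) auto
    then show False using False \<open>\<bar>signed_swap j x\<bar> \<le> int (i + 1)\<close> by simp
  qed
  then show ?thesis using False by (simp add: signed_swap_idle[of _ i])
qed

lemma signed_swap_braid:
  assumes "0 < i"
  shows "signed_swap i (signed_swap (Suc i) (signed_swap i x)) =
         signed_swap (Suc i) (signed_swap i (signed_swap (Suc i) x))"
proof -
  have *: "signed_swap i (signed_swap (Suc i) (signed_swap i x)) =
         signed_swap (Suc i) (signed_swap i (signed_swap (Suc i) x))" if "0 \<le> x" for x
  proof -
    consider "x = int i" | "x = int i + 1" | "x = int i + 2"
      | "x \<noteq> int i" "x \<noteq> int i + 1" "x \<noteq> int i + 2" by blast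
    then show ?thesis by cases (use assms that in \<open>simp_all add: signed_swap_nonneg\<close>)
  qed
  show ?thesis
  proof (cases "0 \<le> x")
    case False
    then show ?thesis using *[of "- x"] by simp
  qed (rule *)
qed

lemma signed_swap_braid4:
  "signed_swap 0 (signed_swap (Suc 0) (signed_swap 0 (signed_swap (Suc 0) x))) =
   signed_swap (Suc 0) (signed_swap 0 (signed_swap (Suc 0) (signed_swap 0 x)))"
proof -
  consider "x = 0" | "x = 1" | "x = 2" | "x = - 1" | "x = - 2" | "\<bar>x\<bar> > 2" by arith
  then show ?thesis
    by cases (simp_all add: signed_swap_def[of _ 0] signed_swap_def[of _ 1] signed_swap_def[of _ 2]
      signed_swap_def[of _ "-1"] signed_swap_def[of _ "-2"] signed_swap_idle)
qed

text \<open>A generator exchanges neighbouring values only, so no other pair can be reversed. For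
  \<open>i = 0\<close> the neighbours are (0, 1) and (-1, 0), while (-1, 1) is ruled out by
  \<open>x \<noteq> - y\<close>.\<close>

lemma signed_swap_less:
  assumes "x < y" "x \<noteq> - y" "x \<noteq> int i \<or> y \<noteq> int i + 1" "x \<noteq> - int i - 1 \<or> y \<noteq> - int i"
  shows "signed_swap i x < signed_swap i y"
proof (cases "i = 0")
  case True
  have vals: "z = 1 \<and> signed_swap i z = - 1 \<or> z = - 1 \<and> signed_swap i z = 1
    \<or> z \<noteq> 1 \<and> z \<noteq> - 1 \<and> signed_swap i z = z" for z
    using True signed_swap_idle[of z i] by (auto simp: signed_swap_def)
  have "x = 0 \<Longrightarrow> y \<noteq> 1" "x = - 1 \<Longrightarrow> y \<noteq> 0" "x = - 1 \<Longrightarrow> y \<noteq> 1" using assms True by auto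
  then show ?thesis using assms(1) vals[of x] vals[of y] by linarith
next
  case False
  obtain I where I: "I = int i" by simp
  have vals: "z = I \<and> signed_swap i z = I + 1 \<or> z = I + 1 \<and> signed_swap i z = I
    \<or> z = - I \<and> signed_swap i z = - I - 1 \<or> z = - I - 1 \<and> signed_swap i z = - I
    \<or> z \<noteq> I \<and> z \<noteq> I + 1 \<and> z \<noteq> - I \<and> z \<noteq> - I - 1 \<and> signed_swap i z = z" for z
    using False by (simp add: signed_swap_def I)
  have "I > 0" using False I by simp
  note hyps = assms[folded I] this
  from vals[of x] vals[of y] hyps show ?thesis
    by (elim disjE conjE) (simp_all only: refl)
qed

lemma signed_swap_less_iff:
  assumes "x \<noteq> y" "x \<noteq> - y"
    and "\<not> (x = int i \<and> y = int i + 1)" "\<not> (y = int i \<and> x = int i + 1)"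
    and "\<not> (x = - int i - 1 \<and> y = - int i)" "\<not> (y = - int i - 1 \<and> x = - int i)"
  shows "signed_swap i x < signed_swap i y \<longleftrightarrow> x < y"
proof -
  have "signed_swap i x < signed_swap i y" if "x < y"
    by (rule signed_swap_less) (use that assms in blast)+
  moreover have "signed_swap i y < signed_swap i x" if "y < x"
    by (rule signed_swap_less) (use that assms in auto)
  ultimately show ?thesis using assms(1) by (meson linorder_neqE not_less_iff_gr_or_eq)
qed

section \<open>Inversions and codes of signed permutations\<close>

definition odd_inj :: "(int \<Rightarrow> int) \<Rightarrow> bool" where
  "odd_inj p \<longleftrightarrow> inj p \<and> (\<forall>x. p (- x) = - p x)"

text \<open>For \<open>p\<close> odd, \<open>w = 0\<close> records the sign of \<open>p v\<close>; it stands for the pair \<open>(- v, v)\<close>, which is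
  excluded by the strict bound.\<close>

definition inversions :: "(int \<Rightarrow> int) \<Rightarrow> nat \<Rightarrow> int set" where
  "inversions p v = {w. \<bar>w\<bar> < int v \<and> p (int v) < p w}"

definition code :: "(int \<Rightarrow> int) \<Rightarrow> nat \<Rightarrow> nat" where
  "code p v = card (inversions p v)"

lemma finite_inversions [simp]: "finite (inversions p v)"
  by (rule finite_subset[of _ "{- int v..int v}"]) (auto simp: inversions_def)

lemma odd_inj_eq_iff:
  assumes "odd_inj p"
  shows "p x = p y \<longleftrightarrow> x = y" "p x = - p y \<longleftrightarrow> x = - y" "- p x = p y \<longleftrightarrow> - x = y"
  using assms unfolding odd_inj_def inj_def by metis+

lemma odd_inj_swap: "odd_inj p \<Longrightarrow> odd_inj (signed_swap i \<circ> p)"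
  unfolding odd_inj_def inj_def by (metis comp_apply signed_swap_involution signed_swap_minus)

text \<open>Composing with the \<open>i\<close>-th generator turns the pair \<open>(w, v)\<close> into an inversion.\<close>

definition creates :: "nat \<Rightarrow> (int \<Rightarrow> int) \<Rightarrow> nat \<Rightarrow> int \<Rightarrow> bool" where
  "creates i p v w \<longleftrightarrow> \<bar>w\<bar> < int v \<and>
     (p (int v) = int i + 1 \<and> p w = int i \<or> p (int v) = - int i \<and> p w = - int i - 1)"

text \<open>By injectivity and oddness no other position paired with \<open>v\<close> carries values
  that the generator exchanges, so every other comparison with \<open>v\<close> survives.\<close>

lemma inversions_swap_creates:
  assumes p: "odd_inj p" and c: "creates i p v w"
  shows "inversions (signed_swap i \<circ> p) v = insert w (inversions p v)" "w \<notin> inversions p v"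
proof -
  note eq = odd_inj_eq_iff[OF p]
  have pv: "p (int v) = int i + 1 \<and> p w = int i \<or> p (int v) = - int i \<and> p w = - int i - 1"
    and w: "\<bar>w\<bar> < int v" using c unfolding creates_def by blast+
  show "w \<notin> inversions p v" using pv unfolding inversions_def by auto
  have w_in: "w \<in> inversions (signed_swap i \<circ> p) v"
    using pv w by (elim disjE conjE) (auto simp: inversions_def signed_swap_def)
  \<comment> \<open>For \<open>i = 0\<close> this excludes \<open>p (int v) = - int i\<close>;
    otherwise the position \<open>- w\<close> would be affected as well.\<close>
  have "p (int v) \<noteq> - p (int v)" using w unfolding eq by simp
  then have "p (int v) \<noteq> 0" by simp
  have "x \<in> inversions (signed_swap i \<circ> p) v \<longleftrightarrow> x \<in> inversions p v" if x: "x \<noteq> w" for x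
  proof (cases "\<bar>x\<bar> < int v")
    case True
    have ne: "p x \<noteq> p w" "p (int v) \<noteq> p x" "p (int v) \<noteq> - p x"
      using True x unfolding eq by auto
    have "signed_swap i (p (int v)) < signed_swap i (p x) \<longleftrightarrow> p (int v) < p x"
      using pv \<open>p (int v) \<noteq> 0\<close> ne by (intro signed_swap_less_iff) linarith+
    then show ?thesis using True by (simp add: inversions_def)
  qed (simp add: inversions_def)
  then show "inversions (signed_swap i \<circ> p) v = insert w (inversions p v)"
    using w_in by (simp only: set_eq_iff insert_iff) metis
qed

lemma code_swap_creates:
  assumes "odd_inj p" "creates i p v w"
  shows "code (signed_swap i \<circ> p) v = Suc (code p v)"
  using inversions_swap_creates[OF assms] by (simp add: code_def)

text \<open>A pair inverted only after the swap has had its order reversed by it, and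
  \<open>signed_swap_less\<close> leaves only created pairs for that.\<close>

lemma inversions_swap_subset:
  assumes p: "odd_inj p" and nc: "\<And>w. \<not> creates i p v w"
  shows "inversions (signed_swap i \<circ> p) v \<subseteq> inversions p v"
proof
  note eq = odd_inj_eq_iff[OF p]
  fix x assume x: "x \<in> inversions (signed_swap i \<circ> p) v"
  then have xv: "\<bar>x\<bar> < int v" and l: "signed_swap i (p (int v)) < signed_swap i (p x)"
    by (auto simp: inversions_def)
  have ne: "p x \<noteq> p (int v)" "p x \<noteq> - p (int v)" using xv by (auto simp: eq)
  have "p (int v) < p x"
  proof (rule ccontr)
    assume "\<not> p (int v) < p x"
    then have "p x < p (int v)" using ne by simp
    moreover have "\<not> (p (int v) = int i + 1 \<and> p x = int i)"
      "\<not> (p (int v) = - int i \<and> p x = - int i - 1)"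
      using nc[of x] xv unfolding creates_def by blast+
    ultimately have "signed_swap i (p x) < signed_swap i (p (int v))"
      using ne by (intro signed_swap_less) auto
    then show False using l by simp
  qed
  then show "x \<in> inversions p v" using xv by (auto simp: inversions_def)
qed

text \<open>The exchanged values sit at \<open>v\<close>, \<open>w\<close> and their negatives. In
  any pair of such positions the one of larger absolute value is \<open>v\<close> up to sign, so no
  comparison counted at \<open>u\<close> is affected.\<close>

lemma code_swap_other:
  assumes p: "odd_inj p" and c: "creates i p v w" and u: "u \<noteq> v"
  shows "code (signed_swap i \<circ> p) u = code p u"
proof -
  note eq = odd_inj_eq_iff[OF p]
  have w: "\<bar>w\<bar> < int v"
    and pv: "p (int v) = int i + 1 \<and> p w = int i \<or> p (int v) = - int i \<and> p w = - int i - 1"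
    using c unfolding creates_def by blast+
  have "signed_swap i (p (int u)) < signed_swap i (p x) \<longleftrightarrow> p (int u) < p x" if x: "\<bar>x\<bar> < int u" for x
  proof -
    have ne: "p (int u) \<noteq> p x" "p (int u) \<noteq> - p x" using x unfolding eq by linarith+
    have "int u \<noteq> int v" using u by simp
    then have ne': "\<not> (p (int u) = p (int v) \<and> p x = p w)" "\<not> (p (int u) = - p (int v) \<and> p x = - p w)"
      "\<not> (p (int u) = p w \<and> p x = p (int v))" "\<not> (p (int u) = - p w \<and> p x = - p (int v))"
      using w x unfolding eq by linarith+
    from pv show ?thesis
    proof (elim disjE conjE)
      assume *: "p (int v) = int i + 1" "p w = int i"
      show ?thesis by (rule signed_swap_less_iff) (use ne ne'[unfolded *] in auto)
    next
      assume *: "p (int v) = - int i" "p w = - int i - 1"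
      show ?thesis by (rule signed_swap_less_iff) (use ne ne'[unfolded *] in auto)
    qed
  qed
  then have "inversions (signed_swap i \<circ> p) u = inversions p u" by (auto simp: inversions_def)
  then show ?thesis by (simp add: code_def)
qed

text \<open>Either one entry grows by one and the others stay, or no pair is created and no entry
  grows.\<close>

lemma sum_code_swap_le:
  assumes p: "odd_inj p" and "finite V"
  shows "(\<Sum>v\<in>V. code (signed_swap i \<circ> p) v) \<le> Suc (\<Sum>v\<in>V. code p v)"
proof (cases "\<exists>v w. creates i p v w")
  case True
  then obtain v w where c: "creates i p v w" by blast
  have "(\<Sum>u\<in>V. code (signed_swap i \<circ> p) u) \<le> (\<Sum>u\<in>V. code p u + (if u = v then 1 else 0))"
    by (intro sum_mono) (use code_swap_creates[OF p c] code_swap_other[OF p c] in auto)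
  also have "\<dots> \<le> Suc (\<Sum>v\<in>V. code p v)"
    using assms(2) by (simp add: sum.distrib)
  finally show ?thesis .
next
  case False
  then have "(\<Sum>u\<in>V. code (signed_swap i \<circ> p) u) \<le> (\<Sum>u\<in>V. code p u)"
    by (intro sum_mono) (auto simp: code_def intro!: card_mono inversions_swap_subset[OF p])
  then show ?thesis by simp
qed

lemma code_id [simp]: "code id v = 0" "code (\<lambda>x. x) v = 0"
proof -
  have "inversions id v = {}" by (auto simp: inversions_def)
  then show "code id v = 0" "code (\<lambda>x. x) v = 0" by (simp_all add: code_def id_def)
qed

text \<open>Letters act from first to last, so right multiplication by a generator becomes
  composition on the left; this is the direction in which codes were studied.\<close>

lemma fold_swap_Suc: "fold signed_swap (w @ [i]) = signed_swap i \<circ> fold signed_swap w"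
  by auto

lemma odd_inj_fold: "odd_inj (fold signed_swap w)"
proof (induction w rule: rev_induct)
  case Nil
  show ?case by (auto simp: odd_inj_def)
next
  case (snoc i w)
  then show ?case unfolding fold_swap_Suc by (rule odd_inj_swap)
qed

text \<open>Source of the lower bound for Coxeter length: the identity has code 0, and each letter
  adds at most one.\<close>

lemma sum_code_le_length:
  assumes "finite V"
  shows "(\<Sum>v\<in>V. code (fold signed_swap w) v) \<le> length w"
proof (induction w rule: rev_induct)
  case (snoc i w)
  have "(\<Sum>v\<in>V. code (fold signed_swap (w @ [i])) v) \<le> Suc (\<Sum>v\<in>V. code (fold signed_swap w) v)"
    unfolding fold_swap_Suc by (rule sum_code_swap_le[OF odd_inj_fold assms])
  then show ?case using snoc.IH by (simp only: length_append_singleton)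
qed (simp add: id_def)

lemma abs_fold_swap_le:
  "set w \<subseteq> {..<k} \<Longrightarrow> \<bar>x\<bar> \<le> int k \<Longrightarrow> \<bar>fold signed_swap w x\<bar> \<le> int k"
  by (induction w arbitrary: x) (auto intro: abs_signed_swap_le)

lemma fold_swap_fixes:
  "set w \<subseteq> {..<k} \<Longrightarrow> \<bar>x\<bar> > int k \<Longrightarrow> fold signed_swap w x = x"
  by (induction w) (auto simp: signed_swap_idle)

lemma fold_swap_rev: "fold signed_swap w (fold signed_swap (rev w) x) = x"
  by (induction w arbitrary: x) auto

lemma fold_swap_preimage:
  assumes "set w \<subseteq> {..<k}" "\<bar>y\<bar> \<le> int k"
  obtains x where "\<bar>x\<bar> \<le> int k" "fold signed_swap w x = y"
  using that[of "fold signed_swap (rev w) y"] abs_fold_swap_le[of "rev w" k y] assms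
  by (simp add: fold_swap_rev)

section \<open>Normal words and their codes\<close>

definition block :: "nat \<Rightarrow> nat list" where
  "block k = rev [1..<k] @ [0..<k]"

lemma length_block [simp]: "length (block k) = k - 1 + k"
  by (simp add: block_def)

lemma block_nth:
  "m < k - 1 + k \<Longrightarrow> block k ! m = (if m < k - 1 then k - 1 - m else m - (k - 1))"
  by (auto simp: block_def nth_append rev_nth)

lemma set_block: "set (block k) \<subseteq> {..<k}"
  by (auto simp: block_def)

text \<open>Each letter moves the image of \<open>k\<close> one step down: \<open>k\<close>, ..., 1,
  then -1, ..., \<open>- k\<close>. The shift by one from \<open>m = k\<close> on comes from
  skipping 0.\<close>

lemma fold_swap_block:
  assumes "0 < k" "m \<le> k - 1 + k"
  shows "fold signed_swap (take m (block k)) (int k) = (if m < k then int k - int m else int k - 1 - int m)"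
  using assms(2)
proof (induction m)
  case (Suc m)
  then have "take (Suc m) (block k) = take m (block k) @ [block k ! m]"
    by (simp add: take_Suc_conv_app_nth)
  then show ?case using Suc assms(1) by (auto simp: block_nth signed_swap_def)
qed (use assms(1) in simp)

primrec normal_word :: "(nat \<Rightarrow> nat) \<Rightarrow> nat \<Rightarrow> nat list" where
  "normal_word m 0 = []"
| "normal_word m (Suc k) = normal_word m k @ take (m (Suc k)) (block (Suc k))"

lemma set_normal_word: "set (normal_word m k) \<subseteq> {..<k}"
proof (induction k)
  case (Suc k)
  then show ?case using set_block[of "Suc k"] set_take_subset[of "m (Suc k)" "block (Suc k)"]
    by fastforce
qed simp

text \<open>The word \<open>w\<close> fixes \<open>Suc k\<close>. Each further letter lowers the
  image of \<open>Suc k\<close> past one neighbouring value and so creates one inversion at that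
  position and none elsewhere.\<close>

lemma code_normal_word_step:
  assumes w: "set w \<subseteq> {..<k}" and q: "q \<le> k + Suc k"
  shows "code (fold signed_swap (w @ take q (block (Suc k)))) =
    (code (fold signed_swap w))(Suc k := code (fold signed_swap w) (Suc k) + q)"
  using q
proof (induction q)
  case (Suc q)
  let ?b = "block (Suc k)" and ?w = "w @ take q (block (Suc k))"
  let ?i = "?b ! q" and ?p = "fold signed_swap ?w"
  have word: "w @ take (Suc q) ?b = ?w @ [?i]"
    using Suc.prems by (simp add: take_Suc_conv_app_nth)
  have W: "set ?w \<subseteq> {..<Suc k}"
    using w set_block[of "Suc k"] set_take_subset[of q ?b] by fastforce
  have pv: "?p (int (Suc k)) = (if q < Suc k then int (Suc k) - int q else int k - int q)"
    using fold_swap_block[of "Suc k" q] fold_swap_fixes[OF w, of "int (Suc k)"] Suc.prems by simp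
  \<comment> \<open>The value that the next letter exchanges with the image of \<open>Suc k\<close>;
    its preimage \<open>x\<close> is the new partner in the inversion. It differs from that image up
    to sign, which forces \<open>x\<close> strictly inside the range.\<close>
  define y where "y = (if q < Suc k then int ?i else - int ?i - 1)"
  have i: "?i = (if q < k then k - q else q - k)"
    using Suc.prems by (subst block_nth) auto
  have "\<bar>y\<bar> \<le> int (Suc k)"
    using Suc.prems by (auto simp: y_def i)
  from fold_swap_preimage[OF W this] obtain x where x: "\<bar>x\<bar> \<le> int (Suc k)" "?p x = y" .
  note eq = odd_inj_eq_iff[OF odd_inj_fold[of ?w]]
  have "?p x \<noteq> ?p (int (Suc k))" "?p x \<noteq> - ?p (int (Suc k))"
    unfolding x(2) pv using Suc.prems by (auto simp: y_def i)
  then have "x \<noteq> int (Suc k)" "x \<noteq> - int (Suc k)" unfolding eq by auto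
  then have c: "creates ?i ?p (Suc k) x"
    unfolding creates_def x(2) pv using x(1) Suc.prems by (auto simp: y_def i)
  have IH: "code ?p = (code (fold signed_swap w))(Suc k := code (fold signed_swap w) (Suc k) + q)"
    by (rule Suc.IH) (use Suc.prems in simp)
  show ?case
    unfolding word fold_swap_Suc
  proof (rule ext)
    fix u
    show "code (signed_swap ?i \<circ> ?p) u =
      ((code (fold signed_swap w))(Suc k := code (fold signed_swap w) (Suc k) + Suc q)) u"
      using code_swap_creates[OF odd_inj_fold c] code_swap_other[OF odd_inj_fold c, of u]
      unfolding IH by (cases "u = Suc k") simp_all
  qed
qed simp

text \<open>Reads the prefix lengths off the permutation alone, which gives both uniqueness of
  normal forms and the length bound.\<close>

lemma code_normal_word:
  assumes "\<And>v. m v \<le> v - 1 + v"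
  shows "code (fold signed_swap (normal_word m k)) v = (if 1 \<le> v \<and> v \<le> k then m v else 0)"
proof (induction k arbitrary: v)
  case (Suc k)
  have le: "m (Suc k) \<le> k + Suc k" using assms[of "Suc k"] by simp
  show ?case
    unfolding normal_word.simps code_normal_word_step[OF set_normal_word le]
    by (simp add: Suc le_Suc_eq)
qed auto

lemma length_normal_word:
  assumes "\<And>v. m v \<le> v - 1 + v"
  shows "length (normal_word m k) = (\<Sum>v=1..k. m v)"
proof (induction k)
  case (Suc k)
  then show ?case using assms[of "Suc k"] by simp
qed simp

lemma normal_word_cong:
  "(\<And>v. 1 \<le> v \<Longrightarrow> v \<le> k \<Longrightarrow> m v = m' v) \<Longrightarrow> normal_word m k = normal_word m' k"
  by (induction k) auto

text \<open>The longer prefix ends in one new letter and the other factors are unchanged. A single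
  inserted letter amounts to right multiplication by a reflection.\<close>

lemma normal_word_increment:
  assumes "1 \<le> x" "x \<le> k" "m x < x - 1 + x"
  shows "\<exists>A s C. normal_word m k = A @ C \<and> normal_word (m(x := Suc (m x))) k = A @ s # C"
  using assms(2)
proof (induction k)
  case (Suc k)
  show ?case
  proof (cases "x = Suc k")
    case True
    have "normal_word (m(x := Suc (m x))) k = normal_word m k"
      by (rule normal_word_cong) (use True in auto)
    moreover have "take (Suc (m x)) (block x) = take (m x) (block x) @ [block x ! m x]"
      using assms(3) by (simp add: take_Suc_conv_app_nth)
    ultimately have "normal_word (m(x := Suc (m x))) (Suc k) = normal_word m (Suc k) @ [block x ! m x]"
      using True by (simp del: fun_upd_apply add: fun_upd_same)
    then show ?thesis by (metis append_Nil2)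
  next
    case False
    then have "x \<le> k" using Suc.prems by simp
    from Suc.IH[OF this] obtain A s C
      where "normal_word m k = A @ C" "normal_word (m(x := Suc (m x))) k = A @ s # C" by blast
    then have "normal_word m (Suc k) = A @ (C @ take (m (Suc k)) (block (Suc k)))"
      "normal_word (m(x := Suc (m x))) (Suc k) = A @ s # (C @ take (m (Suc k)) (block (Suc k)))"
      using False by simp_all
    then show ?thesis by blast
  qed
qed (use assms(1) in simp)

lemma take_block_descending:
  assumes "m < k"
  shows "take m (block k) = rev [k - m..<k]"
proof (rule nth_equalityI)
  show "length (take m (block k)) = length (rev [k - m..<k])" using assms by simp
  fix i assume "i < length (take m (block k))"
  then show "take m (block k) ! i = rev [k - m..<k] ! i" 
    using assms by (simp add: block_nth rev_nth)
qed

text \<open>The letter 0 is moved to the descending factor, so that the two factors have the shapes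
  treated by \<open>descending_shift\<close> and \<open>ascending_shift\<close>.\<close>

lemma take_block_ascending:
  assumes "k \<le> m" "m \<le> k - 1 + k" "0 < k"
  shows "take m (block k) = rev [0..<k] @ [1..<Suc (m - k)]"
proof -
  have "take m (block k) = rev [1..<k] @ [0..<Suc (m - k)]"
    using assms by (simp add: block_def take_upt Suc_diff_le)
  also have "\<dots> = rev [0..<k] @ [1..<Suc (m - k)]"
    using assms by (simp add: upt_conv_Cons[of 0] del: upt_Suc)
  finally show ?thesis .
qed

section \<open>Cubical lattices in Bruhat graphs\<close>

lemma cubical_vertsD:
  assumes "u \<in> cubical_verts k"
  shows "length u = length k" "i < length k \<Longrightarrow> 0 \<le> u ! i" "i < length k \<Longrightarrow> u ! i \<le> int (k ! i)"
  using assms by (auto simp: cubical_verts_def)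

text \<open>Raising one deficient coordinate at a time stays in the lattice; the induction is on the
  total deficit.\<close>

lemma cubical_lattice_rtrancl:
  assumes "u \<in> cubical_verts k" "v \<in> cubical_verts k" "\<And>i. i < length k \<Longrightarrow> u ! i \<le> v ! i"
  shows "(u, v) \<in> (parcs (cubical_lattice k))\<^sup>*"
  using assms
proof (induction "nat (\<Sum>i<length k. v ! i - u ! i)" arbitrary: u rule: less_induct)
  case less
  note u = cubical_vertsD[OF less.prems(1)] and v = cubical_vertsD[OF less.prems(2)]
  show ?case
  proof (cases "\<exists>i<length k. u ! i \<noteq> v ! i")
    case True
    then obtain i where i: "i < length k" "u ! i < v ! i" using less.prems(3) by force
    let ?u = "u[i := u ! i + 1]"
    have nth: "?u ! j = (if j = i then u ! i + 1 else u ! j)" if "j < length k" for j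
      using that u(1) by (simp add: nth_list_update)
    have u': "?u \<in> cubical_verts k"
      unfolding cubical_verts_def using u v i by (force simp: nth_list_update)
    have arc: "(u, ?u) \<in> parcs (cubical_lattice k)"
      unfolding cubical_lattice_def using less.prems(1) u' i by (auto simp: nth)
    have le: "?u ! j \<le> v ! j" if "j < length k" for j
      using that less.prems(3)[OF that] i by (simp add: nth)
    have "(\<Sum>j<length k. v ! j - ?u ! j) = (\<Sum>j<length k. (v ! j - u ! j) - (if j = i then 1 else 0))"
      by (rule sum.cong) (simp_all add: nth)
    also have "\<dots> = (\<Sum>j<length k. v ! j - u ! j) - 1"
      using i by (simp add: sum_subtractf)
    moreover have "0 < (\<Sum>j<length k. v ! j - u ! j)"
      using i less.prems(3) by (intro sum_pos2[of _ i]) auto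
    ultimately have "nat (\<Sum>j<length k. v ! j - ?u ! j) < nat (\<Sum>j<length k. v ! j - u ! j)"
      by linarith
    from less.hyps[OF this u' less.prems(2) le] arc show ?thesis by simp
  next
    case False
    then have "u = v" using u(1) v(1) by (intro nth_equalityI) auto
    then show ?thesis by simp
  qed
qed

lemma sum_list_cubical_arc:
  assumes "(u, v) \<in> parcs (cubical_lattice k)"
  shows "sum_list v = sum_list u + 1"
proof -
  obtain i where i: "i < length k" "\<forall>j<length k. v ! j - u ! j = (if j = i then 1 else 0)"
    and len: "length u = length k" "length v = length k"
    using assms by (auto simp: cubical_lattice_def cubical_verts_def)
  have "sum_list v = (\<Sum>j=0..<length k. u ! j + (if j = i then 1 else 0))"
    unfolding sum_list_sum_nth len by (rule sum.cong) (use i(2) in force)+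
  then show ?thesis using i(1) len by (simp add: sum.distrib sum_list_sum_nth)
qed

lemma sum_list_cubical_max:
  assumes "m \<in> cubical_verts k" "sum_list (map int k) \<le> sum_list m"
  shows "m = map int k"
proof (rule nth_equalityI)
  note m = cubical_vertsD[OF assms(1)]
  show "length m = length (map int k)" using m by simp
  have "(\<Sum>i=0..<length k. int (k ! i) - m ! i) \<le> 0"
    using assms(2) m(1) by (simp add: sum_subtractf sum_list_sum_nth)
  moreover have "\<And>i. i \<in> {0..<length k} \<Longrightarrow> 0 \<le> int (k ! i) - m ! i" using m(3) by auto
  ultimately have "\<forall>i\<in>{0..<length k}. int (k ! i) - m ! i = 0"
    by (metis (no_types, lifting) finite_atLeastLessThan order_antisym sum_nonneg sum_nonneg_eq_0_iff)
  then show "m ! i = map int k ! i" if "i < length m" for i using that m(1) by simp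
qed

text \<open>Reduces cubulation to a bijection turning coordinate sum into length and arcs into
  multiplication by reflections. The sum grows along arcs, so their images are oriented as in the
  Bruhat graph.\<close>

lemma cubulated_by_bruhatI:
  fixes W (structure)
  assumes bij: "bij_betw f (cubical_verts k) (carrier W)"
    and one: "f (replicate (length k) 0) = \<one>"
    and len: "\<And>m. m \<in> cubical_verts k \<Longrightarrow> int (cox_length W S (f m)) = sum_list m"
    and arc: "\<And>u v. (u, v) \<in> parcs (cubical_lattice k) \<Longrightarrow> \<exists>t\<in>reflections W S. f v = f u \<otimes> t"
    and w0: "longest_element W S w\<^sub>0"
  shows "cubulated_by (bruhat_interval_graph W S \<one> w\<^sub>0) k"
proof -
  let ?L = "cubical_lattice k" and ?B = "bruhat_graph W S"
  have pverts: "pverts ?L = cubical_verts k" by (simp add: cubical_lattice_def)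
  have ends: "u \<in> cubical_verts k" "v \<in> cubical_verts k" if "(u, v) \<in> parcs ?L" for u v
    using that by (auto simp: cubical_lattice_def)
  have f_in: "f m \<in> carrier W" if "m \<in> cubical_verts k" for m
    using bij that by (auto simp: bij_betw_def)
  have B_arc: "(f u, f v) \<in> parcs ?B" if "(u, v) \<in> parcs ?L" for u v
  proof -
    have "int (cox_length W S (f u)) < int (cox_length W S (f v))"
      using len ends[OF that] sum_list_cubical_arc[OF that] by simp
    then show ?thesis using arc[OF that] f_in ends[OF that] by (auto simp: bruhat_graph_def)
  qed
  have B_path: "(f u, f v) \<in> (parcs ?B)\<^sup>*" if "(u, v) \<in> (parcs ?L)\<^sup>*" for u v
    using that by (induction) (auto intro: rtrancl_into_rtrancl B_arc)
  have zero: "replicate (length k) 0 \<in> cubical_verts k" and top: "map int k \<in> cubical_verts k"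
    by (auto simp: cubical_verts_def)
  have "w\<^sub>0 \<in> f ` cubical_verts k" using w0 bij by (auto simp: longest_element_def bij_betw_def)
  then obtain m\<^sub>0 where m0: "m\<^sub>0 \<in> cubical_verts k" "w\<^sub>0 = f m\<^sub>0" by blast
  \<comment> \<open>The top corner is the only vertex of maximal coordinate sum, so a longest
    element must be its image.\<close>
  have "cox_length W S (f (map int k)) \<le> cox_length W S w\<^sub>0"
    using w0 f_in[OF top] by (auto simp: longest_element_def)
  then have "m\<^sub>0 = map int k"
    using len[OF top] len[OF m0(1)] m0 by (intro sum_list_cubical_max) simp_all
  then have w0_eq: "w\<^sub>0 = f (map int k)" using m0 by simp
  \<comment> \<open>Every element lies on the image of a lattice path from the origin to the top
    corner.\<close>
  have interval: "bruhat_interval W S \<one> w\<^sub>0 = carrier W"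
  proof (intro equalityI subsetI)
    fix x assume "x \<in> carrier W"
    then obtain m where m: "m \<in> cubical_verts k" "x = f m" using bij by (auto simp: bij_betw_def)
    note D = cubical_vertsD[OF m(1)]
    have "(f (replicate (length k) 0), f m) \<in> (parcs ?B)\<^sup>*" "(f m, f (map int k)) \<in> (parcs ?B)\<^sup>*"
      by (intro B_path cubical_lattice_rtrancl zero top m; simp add: D)+
    then show "x \<in> bruhat_interval W S \<one> w\<^sub>0"
      using f_in[OF zero] f_in[OF top] f_in[OF m(1)] m(2) w0_eq one
      by (simp add: bruhat_interval_def bruhat_le_def)
  qed (simp add: bruhat_interval_def bruhat_le_def)
  \<comment> \<open>The required spanning subgraph is the image of the lattice; arcs are pairs, so
    \<open>f\<close> acts on them componentwise.\<close>
  define hom where "hom = \<lparr>iso_verts = f, iso_arcs = map_prod f f,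
    iso_head = (snd :: 'a \<times> 'a \<Rightarrow> 'a), iso_tail = fst\<rparr>"
  let ?H = "app_iso hom (with_proj ?L)" and ?G = "bruhat_interval_graph W S \<one> w\<^sub>0"
  have inj: "inj_on f (cubical_verts k)" using bij by (simp add: bij_betw_def)
  have arcs_sub: "parcs ?L \<subseteq> cubical_verts k \<times> cubical_verts k" using ends by auto
  have wfL: "wf_digraph (with_proj ?L)"
    by unfold_locales (use ends in \<open>auto simp: pverts\<close>)
  have "inj_on (map_prod f f) (parcs ?L)"
    by (rule inj_on_subset[OF map_prod_inj_on[OF inj inj] arcs_sub])
  then have iso: "pre_digraph.digraph_isomorphism (with_proj ?L) hom"
    unfolding pre_digraph.digraph_isomorphism_def using wfL inj
    by (auto simp: hom_def pverts)
  have G: "verts ?G = carrier W" "arcs ?G = parcs ?B \<inter> carrier W \<times> carrier W" "tail ?G = fst" "head ?G = snd"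
    unfolding bruhat_interval_graph_def induce_subgraph_def interval by auto
  have H: "verts ?H = carrier W" "arcs ?H = map_prod f f ` parcs ?L" "tail ?H = fst" "head ?H = snd"
    using bij by (auto simp: hom_def pverts bij_betw_def)
  have "wf_digraph ?G" by unfold_locales (auto simp: G)
  moreover have "wf_digraph ?H"
    by unfold_locales (unfold H, use ends f_in in auto)
  moreover have "arcs ?H \<subseteq> arcs ?G" unfolding G H using B_arc f_in ends by auto
  ultimately have "spanning ?H ?G"
    unfolding spanning_def subgraph_def compatible_def G H by simp
  then show ?thesis unfolding cubulated_by_def digraph_iso_def using iso by blast
qed

section \<open>Coxeter systems of types A and B\<close>

text \<open>At the last test \<open>i\<close> and \<open>j\<close> are neighbours, so a zero among
  them singles out the pair 0, 1.\<close>

definition coxeter_order :: "nat \<Rightarrow> nat \<Rightarrow> nat" where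
  "coxeter_order i j =
     (if i = j then 1 else if i + 1 < j \<or> j + 1 < i then 2 else if i = 0 \<or> j = 0 then 4 else 3)"

text \<open>Needed for the action on Z to descend to the presented group. Distant letters commute,
  and neighbours satisfy the braid identities.\<close>

lemma fold_swap_relator:
  "fold signed_swap (concat (replicate (coxeter_order i j) [i, j])) x = x"
proof -
  consider "i = j" | "i + 1 < j" | "j + 1 < i" | "i = 0" "j = 1" | "i = 1" "j = 0"
    | "0 < i" "j = Suc i" | "0 < j" "i = Suc j"
    by linarith
  then show ?thesis
  proof cases
    case 2
    then show ?thesis by (simp add: coxeter_order_def numeral_2_eq_2 signed_swap_far[OF 2])
  next
    case 3
    then show ?thesis by (simp add: coxeter_order_def numeral_2_eq_2 signed_swap_far[OF 3])
  next
    case 4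
    then show ?thesis by (simp add: coxeter_order_def numeral_eq_Suc signed_swap_braid4)
  next
    case 5
    then show ?thesis by (simp add: coxeter_order_def numeral_eq_Suc signed_swap_braid4)
  next
    case 6
    then show ?thesis by (simp add: coxeter_order_def numeral_eq_Suc signed_swap_braid)
  next
    case 7
    then show ?thesis by (simp add: coxeter_order_def numeral_eq_Suc signed_swap_braid)
  qed (simp add: coxeter_order_def)
qed

section \<open>Words and braid relations for involutions in a group\<close>

context group
begin

lemma word_prod_closed: "set ws \<subseteq> carrier G \<Longrightarrow> word_prod G ws \<in> carrier G"
  by (induction ws) (auto simp: word_prod_def)

lemma word_prod_Nil [simp]: "word_prod G [] = \<one>"
  by (simp add: word_prod_def)

lemma word_prod_Cons [simp]: "word_prod G (x # ws) = x \<otimes> word_prod G ws"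
  by (simp add: word_prod_def)

lemma word_prod_append:
  assumes "set us \<subseteq> carrier G" "set vs \<subseteq> carrier G"
  shows "word_prod G (us @ vs) = word_prod G us \<otimes> word_prod G vs"
  using assms(1) by (induction us) (auto simp: m_assoc word_prod_closed assms(2))

lemma generate_word_prod:
  assumes "S \<subseteq> carrier G" "\<And>s. s \<in> S \<Longrightarrow> s \<otimes> s = \<one>" "x \<in> generate G S"
  shows "\<exists>ws\<in>lists S. word_prod G ws = x"
  using assms(3)
proof induction
  case one
  show ?case by (intro bexI[of _ "[]"]) auto
next
  case (incl h)
  then show ?case using assms(1) by (intro bexI[of _ "[h]"]) auto
next
  case (inv h)
  then have "inv h = h" using assms(1,2) by (intro inv_equality) auto
  then show ?case using inv assms(1) by (intro bexI[of _ "[h]"]) auto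
next
  case (eng h1 h2)
  then obtain u v where "u \<in> lists S" "v \<in> lists S" "word_prod G u = h1" "word_prod G v = h2" by blast
  then show ?case using assms(1) by (intro bexI[of _ "u @ v"]) (auto intro!: word_prod_append)
qed

lemma ord_mult_commute_involutions:
  assumes "x \<in> carrier G" "y \<in> carrier G" "x \<otimes> x = \<one>" "y \<otimes> y = \<one>"
  shows "ord (x \<otimes> y) = ord (y \<otimes> x)"
proof -
  have "inv x = x" "inv y = y" using assms by (auto intro: inv_equality)
  then have "y \<otimes> x = inv (x \<otimes> y)" using assms by (simp add: inv_mult_group)
  then show ?thesis using assms by simp
qed

text \<open>Here and in the next two lemmas the order of the product yields a braid relation: the
  two halves of the relator are inverse to each other, and inversion reverses a product of
  involutions.\<close>

lemma involutions_commute: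
  assumes xy: "x \<in> carrier G" "y \<in> carrier G" "x \<otimes> x = \<one>" "y \<otimes> y = \<one>" and o: "ord (x \<otimes> y) = 2"
  shows "x \<otimes> y = y \<otimes> x"
proof -
  have inv: "inv x = x" "inv y = y" using xy by (auto intro: inv_equality)
  have "(x \<otimes> y) [^] (2::nat) = \<one>" using pow_ord_eq_1[of "x \<otimes> y"] o xy by simp
  then have "(x \<otimes> y) \<otimes> (x \<otimes> y) = \<one>" using xy by (simp add: numeral_2_eq_2)
  then have "x \<otimes> y = inv (x \<otimes> y)" using xy inv_equality by fastforce
  then show ?thesis using xy by (simp add: inv_mult_group inv)
qed

lemma involutions_braid3:
  assumes xy: "x \<in> carrier G" "y \<in> carrier G" "x \<otimes> x = \<one>" "y \<otimes> y = \<one>" and o: "ord (x \<otimes> y) = 3"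
  shows "x \<otimes> (y \<otimes> x) = y \<otimes> (x \<otimes> y)"
proof -
  have inv: "inv x = x" "inv y = y" using xy by (auto intro: inv_equality)
  have "(x \<otimes> y) [^] (3::nat) = \<one>" using pow_ord_eq_1[of "x \<otimes> y"] o xy by simp
  then have "(x \<otimes> (y \<otimes> x)) \<otimes> (y \<otimes> (x \<otimes> y)) = \<one>" using xy by (simp add: numeral_eq_Suc m_assoc)
  then have "inv (y \<otimes> (x \<otimes> y)) = x \<otimes> (y \<otimes> x)" using xy by (intro inv_equality) auto
  then show ?thesis using xy by (simp add: inv_mult_group inv m_assoc)
qed

lemma involutions_braid4:
  assumes xy: "x \<in> carrier G" "y \<in> carrier G" "x \<otimes> x = \<one>" "y \<otimes> y = \<one>" and o: "ord (x \<otimes> y) = 4"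
  shows "x \<otimes> (y \<otimes> (x \<otimes> y)) = y \<otimes> (x \<otimes> (y \<otimes> x))"
proof -
  have inv: "inv x = x" "inv y = y" using xy by (auto intro: inv_equality)
  have "(x \<otimes> y) [^] (4::nat) = \<one>" using pow_ord_eq_1[of "x \<otimes> y"] o xy by simp
  then have "(x \<otimes> (y \<otimes> (x \<otimes> y))) \<otimes> (x \<otimes> (y \<otimes> (x \<otimes> y))) = \<one>"
    using xy by (simp add: numeral_eq_Suc m_assoc)
  then have "inv (x \<otimes> (y \<otimes> (x \<otimes> y))) = x \<otimes> (y \<otimes> (x \<otimes> y))" using xy by (intro inv_equality) auto
  then show ?thesis using xy by (simp add: inv_mult_group inv m_assoc)
qed

end

text \<open>Type \<open>B_N\<close> for \<open>a = 0\<close> and type \<open>A_(N-1)\<close> for \<open>a = 1\<close>.\<close>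

locale chain_coxeter = group W for W (structure) +
  fixes S :: "'a set" and g :: "nat \<Rightarrow> 'a" and a N :: nat
  assumes cox: "coxeter_system W S"
    and a_le: "a \<le> 1"
    and bij: "bij_betw g {a..<N} S"
    and cox_m_g: "\<And>i j. a \<le> i \<Longrightarrow> i < j \<Longrightarrow> j < N \<Longrightarrow> cox_m W (g i) (g j) = coxeter_order i j"
begin

lemma S_closed: "S \<subseteq> carrier W" and S_ord: "s \<in> S \<Longrightarrow> ord s = 2"
  and gen: "generate W S = carrier W"
  and presentation: "u \<in> lists S \<Longrightarrow> v \<in> lists S \<Longrightarrow> word_prod W u = word_prod W v \<Longrightarrow> cox_equiv W S u v"
  using cox unfolding coxeter_system_def by blast+

lemma S_involution: "s \<in> S \<Longrightarrow> s \<otimes> s = \<one>"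
  using pow_ord_eq_1[of s] S_closed S_ord[of s] by (force simp: numeral_2_eq_2)

lemma g_in: "a \<le> i \<Longrightarrow> i < N \<Longrightarrow> g i \<in> S"
  using bij by (auto simp: bij_betw_def)

lemma g_closed: "a \<le> i \<Longrightarrow> i < N \<Longrightarrow> g i \<in> carrier W"
  using g_in S_closed by blast

lemma g_involution: "a \<le> i \<Longrightarrow> i < N \<Longrightarrow> g i \<otimes> g i = \<one>"
  using g_in S_involution by blast

lemma g_commute:
  assumes "a \<le> i" "i + 1 < j" "j < N"
  shows "g i \<otimes> g j = g j \<otimes> g i"
  using assms cox_m_g[of i j]
  by (intro involutions_commute g_closed g_involution) (auto simp: cox_m_def coxeter_order_def)

lemma g_braid3:
  assumes "a \<le> i" "0 < i" "Suc i < N"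
  shows "g i \<otimes> (g (Suc i) \<otimes> g i) = g (Suc i) \<otimes> (g i \<otimes> g (Suc i))"
  using assms cox_m_g[of i "Suc i"]
  by (intro involutions_braid3 g_closed g_involution) (auto simp: cox_m_def coxeter_order_def)

lemma g_braid4:
  assumes "a = 0" "1 < N"
  shows "g 0 \<otimes> (g 1 \<otimes> (g 0 \<otimes> g 1)) = g 1 \<otimes> (g 0 \<otimes> (g 1 \<otimes> g 0))"
  using assms cox_m_g[of 0 1]
  by (intro involutions_braid4 g_closed g_involution) (auto simp: cox_m_def coxeter_order_def)

lemma cox_m_g_all:
  assumes "i \<in> {a..<N}" "j \<in> {a..<N}"
  shows "cox_m W (g i) (g j) = coxeter_order i j"
proof -
  consider "i < j" | "i = j" | "j < i" by linarith
  then show ?thesis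
  proof cases
    case 1
    then show ?thesis using cox_m_g assms by simp
  next
    case 2
    then show ?thesis using assms by (simp add: cox_m_def g_involution coxeter_order_def)
  next
    case 3
    then have "cox_m W (g i) (g j) = cox_m W (g j) (g i)"
      using assms unfolding cox_m_def
      by (intro ord_mult_commute_involutions g_closed g_involution) auto
    then show ?thesis using cox_m_g[of j i] 3 assms by (auto simp: coxeter_order_def)
  qed
qed

section \<open>The action of the Coxeter group on the integers\<close>

definition index :: "'a \<Rightarrow> nat" where
  "index = inv_into {a..<N} g"

lemma index_g: "i \<in> {a..<N} \<Longrightarrow> index (g i) = i"
  using bij by (simp add: index_def bij_betw_def)

lemma obtain_index:
  assumes "s \<in> S" obtains i where "i \<in> {a..<N}" "s = g i"
  using bij assms by (auto simp: bij_betw_def)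

lemma fold_swap_cox_equiv:
  "cox_equiv W S u v \<Longrightarrow> fold signed_swap (map index u) = fold signed_swap (map index v)"
proof (induction rule: cox_equiv.induct)
  case (relator u v s t)
  obtain i j where ij: "i \<in> {a..<N}" "s = g i" "j \<in> {a..<N}" "t = g j"
    using relator(3,4) obtain_index by metis
  have "map index (concat (replicate (cox_m W s t) [s, t])) =
      concat (replicate (coxeter_order i j) [i, j])"
    using ij by (simp add: map_concat cox_m_g_all index_g)
  then have "fold signed_swap (map index (concat (replicate (cox_m W s t) [s, t]))) x = x" for x
    by (simp only: fold_swap_relator)
  then show ?case by (simp add: fun_eq_iff)
qed auto

definition wp :: "nat list \<Rightarrow> 'a" where
  "wp w = word_prod W (map g w)"

lemma g_lists: "set w \<subseteq> {a..<N} \<Longrightarrow> map g w \<in> lists S"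
  by (auto simp: subset_iff intro!: g_in)

lemma wp_closed: "set w \<subseteq> {a..<N} \<Longrightarrow> wp w \<in> carrier W"
  unfolding wp_def using g_closed by (intro word_prod_closed) auto

lemma wp_Nil [simp]: "wp [] = \<one>" and wp_Cons: "wp (i # w) = g i \<otimes> wp w"
  by (simp_all add: wp_def)

lemma wp_append:
  "set u \<subseteq> {a..<N} \<Longrightarrow> set v \<subseteq> {a..<N} \<Longrightarrow> wp (u @ v) = wp u \<otimes> wp v"
  unfolding wp_def map_append using g_closed by (intro word_prod_append) auto

text \<open>The presentation of \<open>W\<close> enters here: words with equal products are linked
  by relators, and relators act trivially. Hence the permutation depends on the group element
  only.\<close>

lemma fold_swap_word:
  assumes "ws \<in> lists S" "set w \<subseteq> {a..<N}" "word_prod W ws = wp w"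
  shows "fold signed_swap (map index ws) = fold signed_swap w"
proof -
  have "cox_equiv W S ws (map g w)"
    using assms g_lists by (intro presentation) (auto simp: wp_def)
  moreover have "map index (map g w) = w"
    using assms(2) by (auto simp: subset_iff index_g intro!: map_idI)
  ultimately show ?thesis using fold_swap_cox_equiv by metis
qed

section \<open>Moving a generator past a prefix of a block\<close>

lemma wp_commute:
  assumes "set w \<subseteq> {a..<N}" "x \<in> carrier W" "\<And>l. l \<in> set w \<Longrightarrow> g l \<otimes> x = x \<otimes> g l"
  shows "wp w \<otimes> x = x \<otimes> wp w"
  using assms(1,3)
proof (induction w)
  case (Cons l w)
  have c: "g l \<in> carrier W" "wp w \<in> carrier W" using Cons.prems(1) by (auto intro: g_closed wp_closed)
  have IH: "wp w \<otimes> x = x \<otimes> wp w" using Cons by simp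
  have "wp (l # w) \<otimes> x = g l \<otimes> (wp w \<otimes> x)" using c assms(2) by (simp add: wp_Cons m_assoc)
  also have "\<dots> = (g l \<otimes> x) \<otimes> wp w" unfolding IH using c assms(2) by (simp add: m_assoc)
  also have "\<dots> = x \<otimes> wp (l # w)" using Cons.prems(2)[of l] c assms(2) by (simp add: wp_Cons m_assoc)
  finally show ?case .
qed (use assms(2) in simp)

text \<open>From the right, \<open>g (Suc r)\<close> commutes past the letters below
  \<open>r\<close>, becomes \<open>g r\<close> by the braid relation with \<open>g (Suc r)\<close>
  and \<open>g r\<close>, and then commutes past the letters above \<open>Suc r\<close>.\<close>

lemma descending_shift:
  assumes "a \<le> j" "j \<le> r" "0 < r" "Suc r < k" "k \<le> N"
  shows "wp (rev [j..<k]) \<otimes> g (Suc r) = g r \<otimes> wp (rev [j..<k])"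
  using assms(4,5)
proof (induction k)
  case (Suc k)
  have c: "wp (rev [j..<k]) \<in> carrier W" "wp (rev [j..<r]) \<in> carrier W"
    "g k \<in> carrier W" "g r \<in> carrier W" "g (Suc r) \<in> carrier W"
    using assms Suc.prems by (auto intro!: wp_closed g_closed)
  have D: "wp (rev [j..<Suc k]) = g k \<otimes> wp (rev [j..<k])"
    using assms Suc.prems by (simp add: wp_Cons)
  show ?case
  proof (cases "Suc r < k")
    case True
    have comm: "g r \<otimes> g k = g k \<otimes> g r" using assms True Suc.prems by (intro g_commute) auto
    have "wp (rev [j..<Suc k]) \<otimes> g (Suc r) = g k \<otimes> (g r \<otimes> wp (rev [j..<k]))"
      unfolding D using c True Suc by (simp add: m_assoc)
    also have "\<dots> = (g k \<otimes> g r) \<otimes> wp (rev [j..<k])" using c by (simp add: m_assoc)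
    also have "\<dots> = g r \<otimes> wp (rev [j..<Suc k])" unfolding comm[symmetric] D using c by (simp add: m_assoc)
    finally show ?thesis .
  next
    case False
    then have k: "k = Suc r" using Suc.prems by simp
    have D': "wp (rev [j..<k]) = g r \<otimes> wp (rev [j..<r])"
      using assms unfolding k by (simp add: wp_Cons)
    have comm: "wp (rev [j..<r]) \<otimes> g k = g k \<otimes> wp (rev [j..<r])"
      using assms Suc.prems k by (intro wp_commute c g_commute) auto
    have braid: "g k \<otimes> (g r \<otimes> g k) = g r \<otimes> (g k \<otimes> g r)"
      unfolding k using assms Suc.prems by (intro g_braid3[symmetric]) auto
    have "wp (rev [j..<Suc k]) \<otimes> g k = g k \<otimes> (g r \<otimes> (wp (rev [j..<r]) \<otimes> g k))"
      unfolding D D' using c by (simp add: m_assoc)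
    also have "\<dots> = (g k \<otimes> (g r \<otimes> g k)) \<otimes> wp (rev [j..<r])"
      unfolding comm using c by (simp add: m_assoc)
    also have "\<dots> = g r \<otimes> wp (rev [j..<Suc k])"
      unfolding braid D D' using c by (simp add: m_assoc)
    finally show ?thesis unfolding k .
  qed
qed simp

text \<open>Mirror image of \<open>descending_shift\<close>: the braid relation now raises the index
  as the generator passes to the left.\<close>

lemma ascending_shift:
  assumes "0 < r" "Suc r < j" "j \<le> N"
  shows "wp [1..<j] \<otimes> g r = g (Suc r) \<otimes> wp [1..<j]"
  using assms(2,3)
proof (induction j)
  case (Suc j)
  have c: "wp [1..<j] \<in> carrier W" "wp [1..<r] \<in> carrier W"
    "g j \<in> carrier W" "g r \<in> carrier W" "g (Suc r) \<in> carrier W"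
    using assms a_le Suc.prems by (auto intro!: wp_closed g_closed)
  have V: "wp [1..<Suc j] = wp [1..<j] \<otimes> g j"
    using assms(1) a_le Suc.prems c by (simp add: wp_append wp_Cons)
  show ?case
  proof (cases "Suc r < j")
    case True
    have comm: "g r \<otimes> g j = g j \<otimes> g r" using assms a_le True Suc.prems by (intro g_commute) auto
    have "wp [1..<Suc j] \<otimes> g r = wp [1..<j] \<otimes> g r \<otimes> g j"
      unfolding V using c comm by (simp add: m_assoc)
    also have "\<dots> = g (Suc r) \<otimes> wp [1..<Suc j]"
      unfolding V using c Suc True by (simp add: m_assoc)
    finally show ?thesis .
  next
    case False
    then have j: "j = Suc r" using Suc.prems by simp
    have V': "wp [1..<j] = wp [1..<r] \<otimes> g r"
      unfolding j using assms(1) a_le Suc.prems c by (simp add: wp_append wp_Cons)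
    have comm: "wp [1..<r] \<otimes> g j = g j \<otimes> wp [1..<r]"
      using a_le Suc.prems j by (intro wp_commute c g_commute) auto
    have braid: "g r \<otimes> (g j \<otimes> g r) = g j \<otimes> (g r \<otimes> g j)"
      unfolding j using assms a_le Suc.prems by (intro g_braid3) auto
    have "wp [1..<Suc j] \<otimes> g r = wp [1..<r] \<otimes> (g r \<otimes> (g j \<otimes> g r))"
      unfolding V V' using c by (simp add: m_assoc)
    also have "\<dots> = (wp [1..<r] \<otimes> g j) \<otimes> (g r \<otimes> g j)"
      unfolding braid using c by (simp add: m_assoc)
    also have "\<dots> = g j \<otimes> wp [1..<Suc j]"
      unfolding comm V V' using c by (simp add: m_assoc)
    finally show ?thesis unfolding j .
  qed
qed simp

text \<open>The longest admissible prefix: the whole block in type B, and in type A the part before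
  the letter 0.\<close>

definition bound :: "nat \<Rightarrow> nat" where
  "bound v = (if a = 0 then v - 1 + v else v - 1)"

lemma bound_le: "bound v \<le> v - 1 + v"
  by (simp add: bound_def)

lemma set_take_block:
  assumes "m \<le> bound k"
  shows "set (take m (block k)) \<subseteq> {a..<k}"
proof (cases "a = 0")
  case True
  then show ?thesis using set_block[of k] set_take_subset[of m "block k"] by fastforce
next
  case False
  then have m: "m \<le> k - 1" and "a = 1" using a_le assms by (auto simp: bound_def)
  show ?thesis
  proof (cases "k = 0")
    case True
    then show ?thesis by (simp add: block_def)
  next
    case False
    then have "m < k" using m by simp
    then show ?thesis using m \<open>a = 1\<close> by (subst take_block_descending) auto
  qed
qed

text \<open>A form of Deodhar's lemma for the prefixes as minimal coset representatives: a generator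
  on the right lengthens or shortens the prefix by its end letter, or passes through to the left.
  \<open>Suc r < k\<close> places the emerging generator in the next smaller parabolic
  subgroup.\<close>

lemma coset_step:
  assumes k: "k \<le> N" and i: "a \<le> i" "i < k" and m: "m \<le> bound k"
  shows "(\<exists>m'\<le>bound k. wp (take m (block k)) \<otimes> g i = wp (take m' (block k))) \<or>
    (\<exists>r. a \<le> r \<and> Suc r < k \<and> wp (take m (block k)) \<otimes> g i = g r \<otimes> wp (take m (block k)))"
    (is "?stay \<or> ?pass")
proof -
  have gi: "g i \<in> carrier W" using i k by (auto intro: g_closed)
  have c_in: "set (take m' (block k)) \<subseteq> {a..<N}" if "m' \<le> bound k" for m'
    using set_take_block[OF that] k by auto
  note len = bound_le[of k]
  have snoc: "wp (take (Suc m') (block k)) = wp (take m' (block k)) \<otimes> g (block k ! m')"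
    if "Suc m' \<le> bound k" for m'
  proof -
    have "take (Suc m') (block k) = take m' (block k) @ [block k ! m']"
      using that len by (simp add: take_Suc_conv_app_nth)
    moreover have "set (take (Suc m') (block k)) \<subseteq> {a..<N}" by (rule c_in[OF that])
    ultimately show ?thesis using g_closed by (simp add: wp_append wp_Cons)
  qed
  have extend: ?stay if "Suc m \<le> bound k" "block k ! m = i"
    using snoc[OF that(1)] that by metis
  have cancel: ?stay if "0 < m" "block k ! (m - 1) = i"
  proof -
    have "wp (take m (block k)) = wp (take (m - 1) (block k)) \<otimes> g i"
      using snoc[of "m - 1"] that m by simp
    moreover have "wp (take (m - 1) (block k)) \<in> carrier W"
      using m by (intro wp_closed c_in) auto
    ultimately have "wp (take m (block k)) \<otimes> g i = wp (take (m - 1) (block k))"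
      using gi i k by (simp add: m_assoc g_involution)
    then show ?thesis using m by (intro exI[of _ "m - 1"]) simp
  qed
  show ?thesis
  proof (cases "m < k")
    case True
    note c = take_block_descending[OF True]
    \<comment> \<open>The prefix is \<open>k - 1\<close>, ..., \<open>k - m\<close>. In order, the
      generator is its next letter, its last letter, commutes with all its letters, or is shifted by
      a braid relation.\<close>
    consider "Suc i = k - m" | "i = k - m" | "Suc i < k - m" | "k - m < i" by linarith
    then show ?thesis
    proof cases
      case 1
      then have "block k ! m = i" using True by (subst block_nth) auto
      \<comment> \<open>In type A the index \<open>i\<close> is at least 1, so the longer prefix
        still ends before the letter 0.\<close>
      moreover have "Suc m \<le> bound k" using 1 True i a_le by (auto simp: bound_def)
      ultimately show ?thesis using extend by blast
    next
      case 2
      then have "block k ! (m - 1) = i" using True i by (subst block_nth) auto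
      then show ?thesis using cancel 2 i by auto
    next
      case 3
      have "wp (rev [k - m..<k]) \<otimes> g i = g i \<otimes> wp (rev [k - m..<k])"
        using 3 i k gi by (intro wp_commute g_commute[symmetric]) auto
      then have ?pass unfolding c using 3 i by (intro exI[of _ i]) simp
      then show ?thesis ..
    next
      case 4
      then obtain r where r: "i = Suc r" "k - m \<le> r" by (cases i) auto
      have "wp (rev [k - m..<k]) \<otimes> g (Suc r) = g r \<otimes> wp (rev [k - m..<k])"
        using r True i k a_le by (intro descending_shift) auto
      then have ?pass unfolding c r using r True i a_le by (intro exI[of _ r]) simp
      then show ?thesis ..
    qed
  next
    case False
    then have a0: "a = 0" using m i by (auto simp: bound_def split: if_splits)
    then have bound_k: "bound k = k - 1 + k" unfolding bound_def by simp
    \<comment> \<open>The number of letters after the central 0; the prefix ends in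
      \<open>q\<close>.\<close>
    define q where "q = m - k"
    have m_eq: "m = k + q" and q: "q < k" using False m[unfolded bound_k] i by (auto simp: q_def)
    let ?D = "wp (rev [0..<k])" and ?V = "wp [1..<Suc q]"
    have DV: "?D \<in> carrier W" "?V \<in> carrier W" using k q a0 by (auto intro!: wp_closed)
    have "take m (block k) = rev [0..<k] @ [1..<Suc q]"
      unfolding q_def using False m[unfolded bound_k] i by (intro take_block_ascending) auto
    then have c: "wp (take m (block k)) = ?D \<otimes> ?V"
      using k q a0 by (simp add: wp_append del: upt_Suc)
    have pass: ?pass if "Suc r < k" "?D \<otimes> ?V \<otimes> g i = g r \<otimes> (?D \<otimes> ?V)" for r
      unfolding c using that a0 by (intro exI[of _ r]) simp
    \<comment> \<open>After extension and cancellation come three passing cases: \<open>i\<close>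
      commutes with the ascending part and is lowered by the descending one, is raised by the former
      and lowered back by the latter, or is 0 and needs the braid relation of length four.\<close>
    consider "i = Suc q" | "i = q" | "Suc q < i" | "0 < i" "i < q" | "i = 0" "0 < q" by linarith
    then show ?thesis
    proof cases
      case 1
      then have "block k ! m = i" using i m_eq by (subst block_nth) auto
      moreover have "Suc m \<le> bound k" unfolding bound_k using 1 i m_eq by simp
      ultimately show ?thesis using extend by blast
    next
      case 2
      then have "block k ! (m - 1) = i" using i q m_eq by (subst block_nth) auto
      then show ?thesis using cancel 2 i m_eq by auto
    next
      case 3
      then obtain r where r: "i = Suc r" "0 < r" by (cases i) auto
      have V: "?V \<otimes> g i = g i \<otimes> ?V"
        using 3 i k gi a0 by (intro wp_commute g_commute) auto
      have D: "?D \<otimes> g i = g r \<otimes> ?D"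
        unfolding r(1) using r i k a0 by (intro descending_shift) auto
      have gr: "g r \<in> carrier W" using r i k a0 by (intro g_closed) auto
      have "?D \<otimes> ?V \<otimes> g i = (?D \<otimes> g i) \<otimes> ?V" using V DV gi by (simp add: m_assoc)
      also have "\<dots> = g r \<otimes> (?D \<otimes> ?V)" unfolding D using DV gr by (simp add: m_assoc)
      finally show ?thesis using pass r i by auto
    next
      case 4
      have V: "?V \<otimes> g i = g (Suc i) \<otimes> ?V"
        using 4 q k by (intro ascending_shift) auto
      have D: "?D \<otimes> g (Suc i) = g i \<otimes> ?D"
        using 4 q k a0 by (intro descending_shift) auto
      have gs: "g (Suc i) \<in> carrier W" using 4 q k a0 by (intro g_closed) auto
      have "?D \<otimes> ?V \<otimes> g i = (?D \<otimes> g (Suc i)) \<otimes> ?V" using V DV gi gs by (simp add: m_assoc)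
      also have "\<dots> = g i \<otimes> (?D \<otimes> ?V)" unfolding D using DV gi by (simp add: m_assoc)
      finally show ?thesis using pass[of i] 4 q by auto
    next
      case 5
      \<comment> \<open>Splitting off the letters from 2 on exposes the central
        \<open>g 1 \<otimes> g 0 \<otimes> g 1\<close>. Since \<open>g 0\<close> commutes with both
        outer parts, it reaches the centre, and the braid relation releases a \<open>g 0\<close> on
        the left.\<close>
      let ?D2 = "wp (rev [2..<k])" and ?V2 = "wp [2..<Suc q]"
      have cl: "?D2 \<in> carrier W" "?V2 \<in> carrier W" "g 0 \<in> carrier W" "g 1 \<in> carrier W"
        using k q 5 a0 by (auto intro!: wp_closed g_closed)
      have "[0..<k] = 0 # 1 # [2..<k]" using 5 q by (simp add: upt_conv_Cons numeral_2_eq_2)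
      then have D: "?D = ?D2 \<otimes> (g 1 \<otimes> g 0)"
        using k q 5 a0 cl by (simp add: wp_append wp_Cons m_assoc)
      have "[1..<Suc q] = 1 # [2..<Suc q]" using 5 by (simp add: upt_conv_Cons numeral_2_eq_2 del: upt_Suc)
      then have V: "?V = g 1 \<otimes> ?V2" by (simp add: wp_Cons)
      have V2: "?V2 \<otimes> g 0 = g 0 \<otimes> ?V2" and D2: "?D2 \<otimes> g 0 = g 0 \<otimes> ?D2"
        using k q a0 cl by (intro wp_commute g_commute[symmetric]; auto)+
      have braid: "g 1 \<otimes> (g 0 \<otimes> (g 1 \<otimes> g 0)) = g 0 \<otimes> (g 1 \<otimes> (g 0 \<otimes> g 1))"
        using k q 5 a0 by (intro g_braid4[symmetric]) auto
      have "?D \<otimes> ?V \<otimes> g 0 = ?D2 \<otimes> (g 1 \<otimes> (g 0 \<otimes> (g 1 \<otimes> (?V2 \<otimes> g 0))))"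
        unfolding D V using cl by (simp add: m_assoc)
      also have "\<dots> = ?D2 \<otimes> (g 1 \<otimes> (g 0 \<otimes> (g 1 \<otimes> g 0))) \<otimes> ?V2"
        unfolding V2 using cl by (simp add: m_assoc)
      also have "\<dots> = (?D2 \<otimes> g 0) \<otimes> (g 1 \<otimes> (g 0 \<otimes> g 1)) \<otimes> ?V2"
        unfolding braid using cl by (simp add: m_assoc)
      also have "\<dots> = g 0 \<otimes> (?D \<otimes> ?V)"
        unfolding D2 D V using cl by (simp add: m_assoc)
      finally show ?thesis using pass[of 0] 5 q by auto
    qed
  qed
qed

section \<open>Normal forms: existence, uniqueness, length and edges\<close>

lemma set_normal_word_bound:
  assumes "\<And>v. m v \<le> bound v"
  shows "set (normal_word m k) \<subseteq> {a..<k}"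
proof (induction k)
  case (Suc k)
  then show ?case using set_take_block[OF assms, of "Suc k"] by fastforce
qed simp

text \<open>By \<open>coset_step\<close> the last factor either absorbs the generator or passes one
  on to the shorter normal word, where the induction hypothesis applies.\<close>

lemma normal_word_mult_generator:
  assumes "k \<le> N" "a \<le> i" "i < k" "\<And>v. m v \<le> bound v"
  shows "\<exists>m'. (\<forall>v. m' v \<le> bound v) \<and> wp (normal_word m k) \<otimes> g i = wp (normal_word m' k)"
  using assms
proof (induction k arbitrary: i m)
  case (Suc k)
  let ?c = "\<lambda>m. wp (take m (block (Suc k)))"
  have split: "wp (normal_word m' (Suc k)) = wp (normal_word m' k) \<otimes> ?c (m' (Suc k))"
    if "\<And>v. m' v \<le> bound v" for m'
    using set_normal_word_bound[OF that, of k] set_take_block[OF that[of "Suc k"]] Suc.prems(1)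
    by (subst normal_word.simps(2), intro wp_append) auto
  have cl: "wp (normal_word m k) \<in> carrier W" "?c (m (Suc k)) \<in> carrier W" "g i \<in> carrier W"
    using set_normal_word_bound[OF Suc.prems(4), of k] set_take_block[OF Suc.prems(4)[of "Suc k"]] Suc.prems
    by (auto intro!: wp_closed g_closed)
  from coset_step[OF Suc.prems(1-3) Suc.prems(4)[of "Suc k"]] show ?case
  proof (elim disjE exE conjE)
    fix m' assume m': "m' \<le> bound (Suc k)" "?c (m (Suc k)) \<otimes> g i = ?c m'"
    let ?m = "m(Suc k := m')"
    have le: "?m v \<le> bound v" for v using m' Suc.prems(4) by simp
    have "normal_word ?m k = normal_word m k" by (rule normal_word_cong) auto
    then have "wp (normal_word ?m (Suc k)) = wp (normal_word m (Suc k)) \<otimes> g i"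
      unfolding split[OF le] split[OF Suc.prems(4)] using m' cl by (simp add: m_assoc)
    then show ?case using le by metis
  next
    fix r assume r: "a \<le> r" "Suc r < Suc k" "?c (m (Suc k)) \<otimes> g i = g r \<otimes> ?c (m (Suc k))"
    from Suc.IH[of r m] r Suc.prems obtain m1 where
      m1: "\<forall>v. m1 v \<le> bound v" "wp (normal_word m k) \<otimes> g r = wp (normal_word m1 k)" by auto
    let ?m = "m1(Suc k := m (Suc k))"
    have le: "?m v \<le> bound v" for v using m1 Suc.prems(4) by simp
    have gr: "g r \<in> carrier W" using r Suc.prems(1) by (intro g_closed) auto
    have "normal_word ?m k = normal_word m1 k" by (rule normal_word_cong) auto
    then have "wp (normal_word ?m (Suc k)) = wp (normal_word m k) \<otimes> g r \<otimes> ?c (m (Suc k))"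
      unfolding split[OF le] m1(2) by simp
    also have "\<dots> = wp (normal_word m (Suc k)) \<otimes> g i"
      unfolding split[OF Suc.prems(4)] using r(3) gr cl by (simp add: m_assoc)
    finally show ?case using le by metis
  qed
qed simp

lemma normal_word_surj:
  assumes "x \<in> carrier W"
  shows "\<exists>m. (\<forall>v. m v \<le> bound v) \<and> x = wp (normal_word m N)"
proof -
  obtain ws where ws: "ws \<in> lists S" "word_prod W ws = x"
    using generate_word_prod[OF S_closed S_involution] assms gen by blast
  have "\<exists>m. (\<forall>v. m v \<le> bound v) \<and> word_prod W ws = wp (normal_word m N)"
    using ws(1)
  proof (induction ws rule: rev_induct)
    case Nil
    have "normal_word (\<lambda>_. 0) k = []" for k by (induction k) auto
    then show ?case by (intro exI[of _ "\<lambda>_. 0"]) simp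
  next
    case (snoc s ws)
    then obtain m where m: "\<forall>v. m v \<le> bound v" "word_prod W ws = wp (normal_word m N)" by auto
    obtain i where i: "i \<in> {a..<N}" "s = g i" using snoc.prems obtain_index by auto
    have "word_prod W (ws @ [s]) = wp (normal_word m N) \<otimes> g i"
      using snoc.prems S_closed m i g_closed by (subst word_prod_append) auto
    then show ?case using normal_word_mult_generator[of N i m] i m by auto
  qed
  then show ?thesis using ws by simp
qed

lemma code_eq_of_wp_eq:
  assumes "\<And>v. m v \<le> bound v" "\<And>v. m' v \<le> bound v" "wp (normal_word m N) = wp (normal_word m' N)"
    and "1 \<le> v" "v \<le> N"
  shows "m v = m' v"
proof -
  have le: "m v \<le> v - 1 + v" "m' v \<le> v - 1 + v" for v
    using assms(1,2) bound_le order_trans by blast+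
  note set = set_normal_word_bound[OF assms(1), of N] set_normal_word_bound[OF assms(2), of N]
  have "fold signed_swap (normal_word m N) = fold signed_swap (normal_word m' N)"
    using fold_swap_word[OF g_lists[OF set(1)] set(1)] fold_swap_word[OF g_lists[OF set(1)] set(2)] assms(3)
    by (simp add: wp_def)
  then show ?thesis using code_normal_word[of m N v, OF le(1)] code_normal_word[of m' N v, OF le(2)] assms(4,5)
    by simp
qed

text \<open>The normal word attains the value. Any other word for the same element acts by the same
  permutation, whose code sum bounds the length of that word from below.\<close>

lemma cox_length_normal_word:
  assumes "\<And>v. m v \<le> bound v"
  shows "cox_length W S (wp (normal_word m N)) = (\<Sum>v=1..N. m v)"
  unfolding cox_length_def
proof (rule Least_equality)
  have le: "m v \<le> v - 1 + v" for v using assms bound_le order_trans by blast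
  note set = set_normal_word_bound[OF assms, of N]
  show "\<exists>ws\<in>lists S. length ws = (\<Sum>v=1..N. m v) \<and> word_prod W ws = wp (normal_word m N)"
    using g_lists[OF set] length_normal_word[of m, OF le]
    by (intro bexI[of _ "map g (normal_word m N)"]) (simp_all add: wp_def)
  fix y assume "\<exists>ws\<in>lists S. length ws = y \<and> word_prod W ws = wp (normal_word m N)"
  then obtain ws where ws: "ws \<in> lists S" "length ws = y" "word_prod W ws = wp (normal_word m N)" by blast
  have "(\<Sum>v=1..N. m v) = (\<Sum>v=1..N. code (fold signed_swap (normal_word m N)) v)"
    using code_normal_word[of m N, OF le] by (intro sum.cong) auto
  also have "\<dots> \<le> y"
    using sum_code_le_length[of "{1..N}" "map index ws"] ws(2) fold_swap_word[OF ws(1) set ws(3)] by simp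
  finally show "(\<Sum>v=1..N. m v) \<le> y" .
qed

lemma normal_word_edge:
  assumes "\<And>v. m v \<le> bound v" "1 \<le> x" "x \<le> N" "m x < bound x"
  shows "\<exists>t\<in>reflections W S. wp (normal_word (m(x := Suc (m x))) N) = wp (normal_word m N) \<otimes> t"
proof -
  let ?m = "m(x := Suc (m x))"
  have le: "?m v \<le> bound v" for v using assms by simp
  obtain A s C where w: "normal_word m N = A @ C" "normal_word ?m N = A @ s # C"
    using normal_word_increment[of x N m] assms bound_le[of x] by auto
  have set: "set A \<subseteq> {a..<N}" "set C \<subseteq> {a..<N}" "s \<in> {a..<N}"
    using set_normal_word_bound[OF le, of N] unfolding w(2) by auto
  then have cl: "wp A \<in> carrier W" "wp C \<in> carrier W" "g s \<in> carrier W"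
    by (auto intro!: wp_closed g_closed)
  \<comment> \<open>Conjugation carries the letter inserted before \<open>C\<close> to the right
    end; \<open>inv (wp C)\<close> as the conjugating element gives the shape in
    \<open>reflections\<close>.\<close>
  let ?t = "inv (wp C) \<otimes> g s \<otimes> inv (inv (wp C))"
  have "?t \<in> reflections W S"
    unfolding reflections_def using inv_closed[OF cl(2)] g_in[of s] set(3) by fastforce
  moreover have "wp (A @ s # C) = wp (A @ C) \<otimes> ?t"
  proof -
    have cancel: "wp C \<otimes> (inv (wp C) \<otimes> z) = z" if "z \<in> carrier W" for z
      using cl that by (simp flip: m_assoc)
    have "wp (A @ C) \<otimes> ?t = wp A \<otimes> (g s \<otimes> wp C)"
      using cl set by (simp add: wp_append m_assoc cancel)
    also have "\<dots> = wp (A @ s # C)"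
      using cl set by (simp add: wp_append wp_Cons)
    finally show ?thesis by simp
  qed
  ultimately show ?thesis unfolding w by blast
qed

section \<open>The cubulation by prefix lengths\<close>

lemma cubulated:
  assumes "longest_element W S w\<^sub>0"
  shows "cubulated_by (bruhat_interval_graph W S \<one> w\<^sub>0) (map bound [a + 1..<N + 1])"
proof -
  \<comment> \<open>Coordinates start at \<open>a + 1\<close>, because in type A the first prefix is
    always empty.\<close>
  define k where "k = map bound [a + 1..<N + 1]"
  \<comment> \<open>The default 0 keeps the sequence within \<open>bound\<close> at every
    index.\<close>
  define vec where "vec l v = (if a < v \<and> v \<le> N then nat (l ! (v - a - 1)) else 0)" for l :: "int list" and v
  have len: "length k = N - a" unfolding k_def by (simp del: upt_Suc)
  have k_nth: "k ! i = bound (i + a + 1)" if "i < N - a" for i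
    using that unfolding k_def by (simp add: add.commute del: upt_Suc)
  have le: "vec l v \<le> bound v" if "l \<in> cubical_verts k" for l v
  proof (cases "a < v \<and> v \<le> N")
    case True
    then have "l ! (v - a - 1) \<le> int (bound v)"
      using cubical_vertsD(3)[OF that, of "v - a - 1"] k_nth[of "v - a - 1"] len by auto
    then show ?thesis using True by (simp add: vec_def)
  next
    case False
    then show ?thesis by (auto simp: vec_def)
  qed
  have sum: "int (\<Sum>v=1..N. vec l v) = sum_list l" if "l \<in> cubical_verts k" for l
  proof -
    note D = cubical_vertsD[OF that]
    have "(\<Sum>v=1..N. int (vec l v)) = (\<Sum>v\<in>{a+1..<N+1}. l ! (v - a - 1))"
      using D len by (intro sum.mono_neutral_cong_right) (auto simp: vec_def)
    also have "\<dots> = (\<Sum>i\<in>{0..<N - a}. l ! i)"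
      by (rule sum.reindex_bij_witness[of _ "\<lambda>i. i + a + 1" "\<lambda>v. v - a - 1"]) auto
    finally show ?thesis using D(1) len by (simp add: sum_list_sum_nth)
  qed
  show ?thesis unfolding k_def[symmetric]
  proof (rule cubulated_by_bruhatI[where f = "\<lambda>l. wp (normal_word (vec l) N)"])
    show "bij_betw (\<lambda>l. wp (normal_word (vec l) N)) (cubical_verts k) (carrier W)"
      unfolding bij_betw_def
    proof (intro conjI inj_onI equalityI subsetI)
      fix l l' assume l: "l \<in> cubical_verts k" "l' \<in> cubical_verts k"
        and eq: "wp (normal_word (vec l) N) = wp (normal_word (vec l') N)"
      note D = cubical_vertsD[OF l(1)] and D' = cubical_vertsD[OF l(2)]
      show "l = l'"
      proof (rule nth_equalityI)
        show "length l = length l'" using D(1) D'(1) by simp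
        fix i assume "i < length l"
        then have i: "i < N - a" using D(1) len by simp
        have "vec l (i + a + 1) = vec l' (i + a + 1)"
          by (rule code_eq_of_wp_eq[OF le[OF l(1)] le[OF l(2)] eq]) (use i in auto)
        moreover have "a < i + a + 1 \<and> i + a + 1 \<le> N" "i + a + 1 - a - 1 = i" using i by auto
        ultimately have "nat (l ! i) = nat (l' ! i)" by (simp only: vec_def simp_thms if_True)
        then show "l ! i = l' ! i" using D(2)[of i] D'(2)[of i] i len by simp
      qed
    next
      fix x assume "x \<in> (\<lambda>l. wp (normal_word (vec l) N)) ` cubical_verts k"
      then obtain l where l: "l \<in> cubical_verts k" "x = wp (normal_word (vec l) N)" by blast
      show "x \<in> carrier W"
        unfolding l(2) by (intro wp_closed set_normal_word_bound le l)
    next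
      fix x assume "x \<in> carrier W"
      then obtain m where m: "\<forall>v. m v \<le> bound v" "x = wp (normal_word m N)"
        using normal_word_surj by blast
      let ?l = "map (\<lambda>v. int (m v)) [a + 1..<N + 1]"
      have "?l \<in> cubical_verts k" unfolding cubical_verts_def k_def using m(1) by (auto simp del: upt_Suc)
      moreover have "vec ?l v = m v" if "1 \<le> v" "v \<le> N" for v
      proof (cases "a < v")
        case False
        \<comment> \<open>Only \<open>v = 1\<close> in type A remains, where the prefix is forced to
          be empty.\<close>
        then have "bound v = 0" using that a_le by (auto simp: bound_def)
        then show ?thesis using m(1)[rule_format, of v] False by (simp add: vec_def)
      next
        case True
        then have "?l ! (v - a - 1) = int (m v)" using that by (subst nth_map) (auto simp del: upt_Suc)
        then show ?thesis using that True by (simp add: vec_def)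
      qed
      then have "normal_word (vec ?l) N = normal_word m N" by (rule normal_word_cong)
      ultimately show "x \<in> (\<lambda>l. wp (normal_word (vec l) N)) ` cubical_verts k"
        using m(2) by (intro image_eqI[of _ _ ?l]) simp_all
    qed
  next
    have "vec (replicate (length k) 0) v = 0" for v
      by (auto simp: vec_def len)
    then have "normal_word (vec (replicate (length k) 0)) n = []" for n
      by (induction n) auto
    then show "wp (normal_word (vec (replicate (length k) 0)) N) = \<one>" by simp
  next
    fix l assume l: "l \<in> cubical_verts k"
    show "int (cox_length W S (wp (normal_word (vec l) N))) = sum_list l"
      using cox_length_normal_word[of "vec l", OF le[OF l]] sum[OF l] by simp
  next
    fix u v assume "(u, v) \<in> parcs (cubical_lattice k)"
    then obtain i where u: "u \<in> cubical_verts k" and v: "v \<in> cubical_verts k" and i: "i < N - a"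
      and diff: "\<forall>j<N - a. v ! j - u ! j = (if j = i then 1 else 0)"
      unfolding cubical_lattice_def by (auto simp: len)
    let ?x = "i + a + 1"
    have eq: "v ! j = (if j = i then u ! j + 1 else u ! j)" if "j < N - a" for j
      using diff that by force
    have "vec v y = ((vec u)(?x := Suc (vec u ?x))) y" for y
    proof (cases "a < y \<and> y \<le> N")
      case False
      then have "y \<noteq> ?x" using i by auto
      then show ?thesis using False by (auto simp: vec_def)
    next
      case True
      then have y: "y - a - 1 < N - a" by auto
      show ?thesis
      proof (cases "y = ?x")
        case True
        then show ?thesis using i eq[OF i] cubical_vertsD(2)[OF u, of i] len
          by (simp add: vec_def Suc_nat_eq_nat_zadd1 add.commute)
      next
        case False
        then have "y - a - 1 \<noteq> i" using \<open>a < y \<and> y \<le> N\<close> by auto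
        then show ?thesis using False eq[OF y] by (simp add: vec_def)
      qed
    qed
    then have vec: "vec v = (vec u)(?x := Suc (vec u ?x))" by blast
    \<comment> \<open>The head of the arc is a lattice point too, so the incremented entry still
      obeys the bound.\<close>
    have "vec u ?x < bound ?x" using le[OF v, of ?x] by (simp add: vec)
    then show "\<exists>t\<in>reflections W S. wp (normal_word (vec v) N) = wp (normal_word (vec u) N) \<otimes> t"
      unfolding vec using i by (intro normal_word_edge le u) auto
  qed (rule assms)
qed

end

section \<open>The two types as instances of the chain\<close>

theorem mainTheorem5:
  fixes W :: "('a, 'b) monoid_scheme" and S :: "'a set" and w\<^sub>0 :: 'a
  assumes "coxeter_system W S"
    and "finite (carrier W)"
    and "longest_element W S w\<^sub>0"
  shows "(\<forall>n\<ge>1. coxeter_type_A W S n \<longrightarrow>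
            cubulated_by (bruhat_interval_graph W S \<one>\<^bsub>W\<^esub> w\<^sub>0) [1..<n+1]) \<and>
         (\<forall>n\<ge>2. coxeter_type_B W S n \<longrightarrow>
            cubulated_by (bruhat_interval_graph W S \<one>\<^bsub>W\<^esub> w\<^sub>0) (map (\<lambda>i. 2 * i - 1) [1..<n+1]))"
proof (intro conjI allI impI)
  interpret group W using assms(1) by (simp add: coxeter_system_def)
  fix n :: nat assume "1 \<le> n" "coxeter_type_A W S n"
  then obtain s where s: "bij_betw s {1..n} S"
    "\<And>i j. i \<in> {1..n} \<Longrightarrow> j \<in> {1..n} \<Longrightarrow> i < j \<Longrightarrow> cox_m W (s i) (s j) = (if j = i + 1 then 3 else 2)"
    unfolding coxeter_type_A_def by blast
  interpret chain_coxeter W S s 1 "n + 1"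
  proof
    have "{1..<n + 1} = {1..n}" by auto
    then show "bij_betw s {1..<n + 1} S" using s(1) by simp
    fix i j assume "1 \<le> i" "i < j" "j < n + 1"
    then show "cox_m W (s i) (s j) = coxeter_order i j"
      using s(2)[of i j] by (auto simp: coxeter_order_def)
  qed (use assms in auto)
  have "bound = (\<lambda>v. v - 1)" by (rule ext, unfold bound_def) simp
  \<comment> \<open>The coordinates run over \<open>v = 2\<close>, ..., \<open>n + 1\<close>, with
    bounds \<open>v - 1\<close>.\<close>
  then have "map bound [1 + 1..<n + 1 + 1] = [1..<n + 1]"
    by (simp only:) (rule nth_equalityI; simp del: upt_Suc)
  then show "cubulated_by (bruhat_interval_graph W S \<one>\<^bsub>W\<^esub> w\<^sub>0) [1..<n+1]"
    using cubulated[OF assms(3)] by (simp only:)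
next
  interpret group W using assms(1) by (simp add: coxeter_system_def)
  fix n :: nat assume n: "2 \<le> n" "coxeter_type_B W S n"
  then obtain s where s: "bij_betw s {1..n} S"
    "\<And>i j. i \<in> {1..n} \<Longrightarrow> j \<in> {1..n} \<Longrightarrow> i < j \<Longrightarrow>
      cox_m W (s i) (s j) = (if j = i + 1 then (if j = n then 4 else 3) else 2)"
    unfolding coxeter_type_B_def by blast
  have S: "S \<subseteq> carrier W" "\<And>x. x \<in> S \<Longrightarrow> ord x = 2" using assms(1) by (auto simp: coxeter_system_def)
  have inv: "x \<otimes>\<^bsub>W\<^esub> x = \<one>\<^bsub>W\<^esub>" if "x \<in> S" for x
    using pow_ord_eq_1[of x] S that by (force simp: numeral_2_eq_2)
  \<comment> \<open>The numbering is reversed: the label 4 sits at the end of the given path but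
    between 0 and 1 in the chain.\<close>
  interpret chain_coxeter W S "\<lambda>i. s (n - i)" 0 n
  proof
    have "bij_betw (\<lambda>i. n - i) {0..<n} {1..n}"
      by (rule bij_betw_byWitness[where f' = "\<lambda>i. n - i"]) auto
    from bij_betw_trans[OF this s(1)] show "bij_betw (\<lambda>i. s (n - i)) {0..<n} S" by (simp add: o_def)
    fix i j assume ij: "0 \<le> i" "i < j" "j < n"
    then have "s (n - i) \<in> S" "s (n - j) \<in> S" using s(1) by (auto simp: bij_betw_def)
    then have "cox_m W (s (n - i)) (s (n - j)) = cox_m W (s (n - j)) (s (n - i))"
      unfolding cox_m_def using S inv by (intro ord_mult_commute_involutions) auto
    then show "cox_m W (s (n - i)) (s (n - j)) = coxeter_order i j"
      using s(2)[of "n - j" "n - i"] ij by (auto simp: coxeter_order_def)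
  qed (use assms in auto)
  have "map bound [0 + 1..<n + 1] = map (\<lambda>i. 2 * i - 1) [1..<n + 1]"
    by (auto simp: bound_def simp del: upt_Suc)
  then show "cubulated_by (bruhat_interval_graph W S \<one>\<^bsub>W\<^esub> w\<^sub>0) (map (\<lambda>i. 2 * i - 1) [1..<n+1])"
    using cubulated[OF assms(3)] by (simp only:)
qed

end
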